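(* Let $S_n=(\mathcal{V},(m_i)_{0\le i\le n-1})$ be a locally finite weighted oriented $n$-simplicial complex. Assume: (i) there exist finite sets $O_k\subset\mathcal{V}$ ($k\ge 1$) with $O_k\nearrow\mathcal{V}$ and functions $\chi_k:\mathcal{V}\to[0,1]$ such that, for every $k$, $\chi_k$ has finite support and $\chi_k(x)=1$ for every $x\in O_k$; (ii) for every $i\in\{0,1,\dots,n-2\}$, $\sup_\sigma d_{m_i}(\sigma)<\infty$, the supremum being over all $i$-simplices $\sigma$. Then the Gauss--Bonnet operator $D=d+\delta$ is essentially self-adjoint on $\bigoplus_{i=0}^{n-1}C_c^i(\mathcal{V})$ (as an operator in $\mathcal{H}$). In particular, if $S_n$ is globally $\chi$-complete and $\sup_\sigma d_{m_i}(\sigma)<\infty$ for every $i\in\{0,\dots,n-2\}$, then $D$ is essentially self-adjoint on $\bigoplus_{i=0}^{n-1}C_c^i(\mathcal{V})$.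
   Context: Complex. $\mathcal{V}$ is a countable set, $m_0:\mathcal{V}\to(0,\infty)$, and $m_1:\mathcal{V}\times\mathcal{V}\to[0,\infty)$ is symmetric with $m_1(x,x)=0$. Write $x\sim y$ (neighbours) if $m_1(x,y)>0$. Locally finite means every vertex has finitely many neighbours. Fix an integer $n\ge2$. For $0\le i\le n-1$, $\mathcal{F}_i$ is the set of ordered tuples $(x_0,\dots,x_i)$ of pairwise adjacent vertices (cliques); these are the $i$-simplices. $P_i$ is the quotient of $\mathcal{F}_i$ by even permutations; $-\tau$ denotes the opposite orientation of $\tau\in P_i$. The weights $m_i:\mathcal{V}^{i+1}\to[0,\infty)$, $0\le i\le n-1$, are invariant under all permutations and positive exactly on $\mathcal{F}_i$. $S_n=(\mathcal{V},(m_i)_{0\le i\le n-1})$ is the weighted oriented $n$-simplicial complex (simplices have at most $n$ vertices). For $1\le i\le n-1$ and an $(i-1)$-simplex, $F(x_0,\dots,x_{i-1})$ is the set of common neighbours of $x_0,\dots,x_{i-1}$, and the weighted degree is $$d_{m_{i-1}}(x_0,\dots,x_{i-1})=\frac1{m_{i-1}(x_0,\dots,x_{i-1})}\sum_{x_i\in F(x_0,\dots,x_{i-1})}m_i(x_0,\dots,x_i).$$ Cochains. $C_c^i(\mathcal{V})$ is the space of finitely supported $f:P_i\to\mathbb{C}$ with $f(-\tau)=-f(\tau)$ (alternating functions on $\mathcal{F}_i$), with inner product $\langle f,g\rangle_{\ell^2(m_i)}=\frac1{(i+1)!}\sum_{(x_0,\dots,x_i)\in\mathcal{F}_i}m_i(x_0,\dots,x_i)\overline{f(x_0,\dots,x_i)}g(x_0,\dots,x_i)$;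 $\ell^2(m_i)$ is its completion and $\mathcal{H}=\bigoplus_{i=0}^{n-1}\ell^2(m_i)$. Operators. For $0\le i\le n-2$, $d_if(x_0,\dots,x_{i+1})=\sum_{j=0}^{i+1}(-1)^jf(x_0,\dots,\widehat{x_j},\dots,x_{i+1})$. For $1\le i\le n-1$, $$\delta_ig(x_0,\dots,x_{i-1})=\frac{(-1)^i}{m_{i-1}(x_0,\dots,x_{i-1})}\sum_{x_i\in F(x_0,\dots,x_{i-1})}m_i(x_0,\dots,x_i)g(x_0,\dots,x_i).$$ $D=d+\delta$ acts on $F=(f_0,\dots,f_{n-1})$ by $(DF)_i=d_{i-1}f_{i-1}+\delta_{i+1}f_{i+1}$, where terms with index out of range are $0$. $\chi$-completeness. $O_k\nearrow\mathcal{V}$ means the $O_k$ increase with union $\mathcal{V}$. For $\chi:\mathcal{V}\to[0,1]$ and $1\le\ell\le n-1$ the energy at level $\ell$ is $$E_\ell(\chi)=\frac1{\ell!}\sum_{(x_0,\dots,x_{\ell-1})\in P_{\ell-1}^+}\frac1{m_{\ell-1}(x_0,\dots,x_{\ell-1})}\sum_{x_\ell\in F(x_0,\dots,x_{\ell-1})}m_\ell(x_0,\dots,x_\ell)\sum_{j=0}^\ell|a_j|^2,$$ where $P_{\ell-1}^+$ contains exactly one orientation of each $(\ell-1)$-simplex and $a_j=\frac{S-(\ell+1)\chi(x_j)}{\ell(\ell+1)}$, $S=\sum_{k=0}^\ell\chi(x_k)$. $S_n$ is globally $\chi$-complete if there are finite sets $O_k\nearrow\mathcal{V}$ ($k\in\mathbb{N}$),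 functions $\chi_k:\mathcal{V}\to[0,1]$ and a constant $C>0$ such that for all $k$ and all $1\le\ell\le n-1$: $\chi_k$ has finite support, $\chi_k=1$ on $O_k$, and $E_\ell(\chi_k)\le C$. *)

theory Defs
  imports
    "HOL-Analysis.Analysis"
    "HOL-Combinatorics.Permutations"
    "HOL-Library.Function_Algebras"
begin

section \<open>Unbounded operators in a complex Hilbert space\<close>

text \<open>
  The Hilbert space is a carrier \<open>H\<close> inside an additive group, with a complex inner product
  \<open>ip\<close> that is antilinear in the first argument. Operators are given by their graphs.
\<close>

definition hnorm :: "('h \<Rightarrow> 'h \<Rightarrow> complex) \<Rightarrow> 'h \<Rightarrow> real" where
  "hnorm ip u = sqrt (Re (ip u u))"

definition hlim :: "('h::ab_group_add \<Rightarrow> 'h \<Rightarrow> complex) \<Rightarrow> (nat \<Rightarrow> 'h) \<Rightarrow> 'h \<Rightarrow> bool" where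
  "hlim ip s u \<longleftrightarrow> (\<lambda>k. hnorm ip (s k - u)) \<longlonglongrightarrow> 0"

definition dense_in ::
  "'h::ab_group_add set \<Rightarrow> ('h \<Rightarrow> 'h \<Rightarrow> complex) \<Rightarrow> 'h set \<Rightarrow> bool" where
  "dense_in H ip A \<longleftrightarrow> A \<subseteq> H \<and> (\<forall>u\<in>H. \<exists>s. (\<forall>k. s k \<in> A) \<and> hlim ip s u)"

definition op_graph :: "'h set \<Rightarrow> ('h \<Rightarrow> 'h) \<Rightarrow> ('h \<times> 'h) set" where
  "op_graph A T = {(u, T u) | u. u \<in> A}"

definition closure_graph ::
  "'h::ab_group_add set \<Rightarrow> ('h \<Rightarrow> 'h \<Rightarrow> complex) \<Rightarrow> ('h \<times> 'h) set \<Rightarrow> ('h \<times> 'h) set" where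
  "closure_graph H ip G =
     {(u, v). u \<in> H \<and> v \<in> H \<and>
        (\<exists>s t. (\<forall>k. (s k, t k) \<in> G) \<and> hlim ip s u \<and> hlim ip t v)}"

definition adjoint_graph ::
  "'h set \<Rightarrow> ('h \<Rightarrow> 'h \<Rightarrow> complex) \<Rightarrow> ('h \<times> 'h) set \<Rightarrow> ('h \<times> 'h) set" where
  "adjoint_graph H ip G =
     {(y, z). y \<in> H \<and> z \<in> H \<and> (\<forall>(u, v)\<in>G. ip v y = ip u z)}"

definition self_adjoint_graph ::
  "'h::ab_group_add set \<Rightarrow> ('h \<Rightarrow> 'h \<Rightarrow> complex) \<Rightarrow> ('h \<times> 'h) set \<Rightarrow> bool" where
  "self_adjoint_graph H ip G \<longleftrightarrow>
     single_valued G \<and> dense_in H ip (Domain G) \<and> adjoint_graph H ip G = G"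

text \<open>
  The operator \<open>T\<close> with domain \<open>A\<close> is densely defined and closable, and its closure is
  self-adjoint. Closability is the single-valuedness of the closed graph.
\<close>

definition essentially_self_adjoint ::
  "'h::ab_group_add set \<Rightarrow> ('h \<Rightarrow> 'h \<Rightarrow> complex) \<Rightarrow> 'h set \<Rightarrow> ('h \<Rightarrow> 'h) \<Rightarrow> bool" where
  "essentially_self_adjoint H ip A T \<longleftrightarrow>
     dense_in H ip A \<and> T ` A \<subseteq> H \<and>
     self_adjoint_graph H ip (closure_graph H ip (op_graph A T))"

section \<open>Weighted oriented simplicial complexes\<close>

text \<open>
  The tuple \<open>(x\<^sub>0, \<dots>, x\<^sub>i)\<close> is a list of length \<open>i + 1\<close>, and \<open>m i\<close> is the
  weight \<open>m\<^sub>i\<close>; only its values on such lists over \<open>V\<close> matter.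
\<close>

definition adjacent :: "(nat \<Rightarrow> 'v list \<Rightarrow> real) \<Rightarrow> 'v \<Rightarrow> 'v \<Rightarrow> bool" where
  "adjacent m x y \<longleftrightarrow> 0 < m 1 [x, y]"

definition simplices ::
  "'v set \<Rightarrow> (nat \<Rightarrow> 'v list \<Rightarrow> real) \<Rightarrow> nat \<Rightarrow> 'v list set" where
  "simplices V m i =
     {xs. length xs = i + 1 \<and> set xs \<subseteq> V \<and>
          (\<forall>a<length xs. \<forall>b<length xs. a \<noteq> b \<longrightarrow> adjacent m (xs ! a) (xs ! b))}"

definition weighted_complex ::
  "'v set \<Rightarrow> (nat \<Rightarrow> 'v list \<Rightarrow> real) \<Rightarrow> nat \<Rightarrow> bool" where
  "weighted_complex V m n \<longleftrightarrow>
     2 \<le> n \<and> countable V \<and>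
     (\<forall>x\<in>V. m 1 [x, x] = 0) \<and>
     (\<forall>i<n. \<forall>xs. length xs = i + 1 \<and> set xs \<subseteq> V \<longrightarrow>
        0 \<le> m i xs \<and>
        (\<forall>ys. mset ys = mset xs \<longrightarrow> m i ys = m i xs) \<and>
        (0 < m i xs \<longleftrightarrow> xs \<in> simplices V m i))"

definition locally_finite :: "'v set \<Rightarrow> (nat \<Rightarrow> 'v list \<Rightarrow> real) \<Rightarrow> bool" where
  "locally_finite V m \<longleftrightarrow> (\<forall>x\<in>V. finite {y \<in> V. adjacent m x y})"

definition common_neighbours ::
  "'v set \<Rightarrow> (nat \<Rightarrow> 'v list \<Rightarrow> real) \<Rightarrow> 'v list \<Rightarrow> 'v set" where
  "common_neighbours V m xs = {y \<in> V. \<forall>x\<in>set xs. adjacent m x y}"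

definition weighted_degree ::
  "'v set \<Rightarrow> (nat \<Rightarrow> 'v list \<Rightarrow> real) \<Rightarrow> nat \<Rightarrow> 'v list \<Rightarrow> real" where
  "weighted_degree V m i xs =
     1 / m i xs * (\<Sum>y\<in>common_neighbours V m xs. m (i + 1) (xs @ [y]))"

section \<open>Cochains\<close>

text \<open>
  A function on oriented simplices that changes sign with the orientation is the same as an
  alternating function on tuples. Cochains are extended by zero off the simplices, so that
  equality of cochains is equality of functions.
\<close>

definition alternating_cochain ::
  "'v set \<Rightarrow> (nat \<Rightarrow> 'v list \<Rightarrow> real) \<Rightarrow> nat \<Rightarrow> ('v list \<Rightarrow> complex) \<Rightarrow> bool" where
  "alternating_cochain V m i f \<longleftrightarrow>
     (\<forall>xs. xs \<notin> simplices V m i \<longrightarrow> f xs = 0) \<and>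
     (\<forall>xs\<in>simplices V m i. \<forall>p. p permutes {..<length xs} \<longrightarrow>
        f (permute_list p xs) = of_int (sign p) * f xs)"

definition cochains_c ::
  "'v set \<Rightarrow> (nat \<Rightarrow> 'v list \<Rightarrow> real) \<Rightarrow> nat \<Rightarrow> ('v list \<Rightarrow> complex) set" where
  "cochains_c V m i = {f. alternating_cochain V m i f \<and> finite {xs. f xs \<noteq> 0}}"

text \<open>
  Since the weight is positive on simplices, the completion of \<open>cochains_c V m i\<close> is the space
  of weighted square-summable alternating cochains.
\<close>

definition cochains_l2 ::
  "'v set \<Rightarrow> (nat \<Rightarrow> 'v list \<Rightarrow> real) \<Rightarrow> nat \<Rightarrow> ('v list \<Rightarrow> complex) set" where
  "cochains_l2 V m i =
     {f. alternating_cochain V m i f \<and>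
         (\<lambda>xs. m i xs * (cmod (f xs))\<^sup>2) summable_on simplices V m i}"

definition inner_l2 ::
  "'v set \<Rightarrow> (nat \<Rightarrow> 'v list \<Rightarrow> real) \<Rightarrow> nat \<Rightarrow>
     ('v list \<Rightarrow> complex) \<Rightarrow> ('v list \<Rightarrow> complex) \<Rightarrow> complex" where
  "inner_l2 V m i f g =
     1 / fact (i + 1) *
       (\<Sum>\<^sub>\<infinity>xs\<in>simplices V m i. complex_of_real (m i xs) * cnj (f xs) * g xs)"

text \<open>An element of the direct sum over \<open>i < n\<close> is a family that vanishes from index \<open>n\<close> on.\<close>

definition direct_sum ::
  "nat \<Rightarrow> (nat \<Rightarrow> ('v list \<Rightarrow> complex) set) \<Rightarrow> (nat \<Rightarrow> 'v list \<Rightarrow> complex) set" where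
  "direct_sum n X = {F. (\<forall>i<n. F i \<in> X i) \<and> (\<forall>i\<ge>n. F i = 0)}"

definition inner_sum ::
  "'v set \<Rightarrow> (nat \<Rightarrow> 'v list \<Rightarrow> real) \<Rightarrow> nat \<Rightarrow>
     (nat \<Rightarrow> 'v list \<Rightarrow> complex) \<Rightarrow> (nat \<Rightarrow> 'v list \<Rightarrow> complex) \<Rightarrow> complex" where
  "inner_sum V m n F G = (\<Sum>i<n. inner_l2 V m i (F i) (G i))"

section \<open>The Gauss--Bonnet operator\<close>

definition coboundary ::
  "'v set \<Rightarrow> (nat \<Rightarrow> 'v list \<Rightarrow> real) \<Rightarrow> nat \<Rightarrow>
     ('v list \<Rightarrow> complex) \<Rightarrow> 'v list \<Rightarrow> complex" where
  "coboundary V m i f xs =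
     (if xs \<in> simplices V m (i + 1)
      then \<Sum>j\<le>i + 1. (-1) ^ j * f (take j xs @ drop (j + 1) xs) else 0)"

text \<open>\<open>codiff V m i\<close> is \<open>\<delta>\<^sub>i\<close>, from level \<open>i\<close> to level \<open>i - 1\<close>, for \<open>i \<ge> 1\<close>.\<close>

definition codiff ::
  "'v set \<Rightarrow> (nat \<Rightarrow> 'v list \<Rightarrow> real) \<Rightarrow> nat \<Rightarrow>
     ('v list \<Rightarrow> complex) \<Rightarrow> 'v list \<Rightarrow> complex" where
  "codiff V m i g xs =
     (if xs \<in> simplices V m (i - 1)
      then (-1) ^ i / complex_of_real (m (i - 1) xs) *
        (\<Sum>y\<in>common_neighbours V m xs. complex_of_real (m i (xs @ [y])) * g (xs @ [y]))
      else 0)"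

definition gauss_bonnet ::
  "'v set \<Rightarrow> (nat \<Rightarrow> 'v list \<Rightarrow> real) \<Rightarrow> nat \<Rightarrow>
     (nat \<Rightarrow> 'v list \<Rightarrow> complex) \<Rightarrow> nat \<Rightarrow> 'v list \<Rightarrow> complex" where
  "gauss_bonnet V m n F i =
     (if 1 \<le> i \<and> i < n then coboundary V m (i - 1) (F (i - 1)) else 0) +
     (if i + 1 < n then codiff V m (i + 1) (F (i + 1)) else 0)"

section \<open>Cut-off functions and completeness\<close>

definition cutoff_sequence ::
  "'v set \<Rightarrow> (nat \<Rightarrow> 'v set) \<Rightarrow> (nat \<Rightarrow> 'v \<Rightarrow> real) \<Rightarrow> bool" where
  "cutoff_sequence V U chi \<longleftrightarrow>
     incseq U \<and> (\<Union>k. U k) = V \<and>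
     (\<forall>k. finite (U k) \<and>
          (\<forall>x\<in>V. 0 \<le> chi k x \<and> chi k x \<le> 1) \<and>
          finite {x \<in> V. chi k x \<noteq> 0} \<and>
          (\<forall>x\<in>U k. chi k x = 1))"

text \<open>
  One chosen ordering of the vertices of each simplex. The summand of the energy is invariant
  under permutations, so the choice is immaterial.
\<close>

definition positive_simplices ::
  "'v set \<Rightarrow> (nat \<Rightarrow> 'v list \<Rightarrow> real) \<Rightarrow> nat \<Rightarrow> 'v list set" where
  "positive_simplices V m i =
     (\<lambda>\<sigma>. SOME xs. xs \<in> simplices V m i \<and> set xs = \<sigma>) ` (set ` simplices V m i)"

text \<open>\<open>energy_coeff l chi xs j\<close> is \<open>a\<^sub>j\<close> for the tuple \<open>xs\<close> of length \<open>l + 1\<close>.\<close>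

definition energy_coeff :: "nat \<Rightarrow> ('v \<Rightarrow> real) \<Rightarrow> 'v list \<Rightarrow> nat \<Rightarrow> real" where
  "energy_coeff l chi xs j =
     ((\<Sum>k\<le>l. chi (xs ! k)) - (real l + 1) * chi (xs ! j)) / (real l * (real l + 1))"

definition energy ::
  "'v set \<Rightarrow> (nat \<Rightarrow> 'v list \<Rightarrow> real) \<Rightarrow> nat \<Rightarrow> ('v \<Rightarrow> real) \<Rightarrow> ennreal" where
  "energy V m l chi =
     ennreal (1 / fact l) *
     (\<Sum>\<^sub>\<infinity>xs\<in>positive_simplices V m (l - 1).
        ennreal (1 / m (l - 1) xs *
          (\<Sum>y\<in>common_neighbours V m xs.
             m l (xs @ [y]) * (\<Sum>j\<le>l. \<bar>energy_coeff l chi (xs @ [y]) j\<bar>\<^sup>2))))"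

definition globally_chi_complete ::
  "'v set \<Rightarrow> (nat \<Rightarrow> 'v list \<Rightarrow> real) \<Rightarrow> nat \<Rightarrow> bool" where
  "globally_chi_complete V m n \<longleftrightarrow>
     (\<exists>U chi C. 0 < C \<and> cutoff_sequence V U chi \<and>
        (\<forall>k. \<forall>l\<in>{1..n - 1}. energy V m l (chi k) \<le> ennreal C))"

end

theory Submission
  imports Defs
begin

text \<open>
  The bound on the weighted degrees makes the Gauss--Bonnet operator bounded, and a bounded
  symmetric operator restricted to a dense subspace has a self-adjoint closure, namely its
  bounded extension (\<open>essentially_self_adjoint_bounded_symmetric\<close>). The graph of the
  closure is then the graph of \<open>D\<close> on the whole Hilbert space.

  Everything about \<open>D\<close> rests on one change of summation: an \<open>(i+1)\<close>-simplex is an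
  \<open>i\<close>-simplex followed by a common neighbour of its vertices. Summing
  \<open>m\<^sub>i\<^sub>+\<^sub>1(x\<^sub>0, \<dots>, x\<^sub>i\<^sub>+\<^sub>1) \<phi>(x\<^sub>0, \<dots>, x\<^sub>i)\<close> over the last vertex first produces the
  factor \<open>m\<^sub>i\<close> times the weighted degree, so this sum is at most \<open>K\<close> times the sum of
  \<open>m\<^sub>i \<phi>\<close> (\<open>has_sum_extension\<close>). With the Cauchy--Schwarz inequality this bounds
  \<open>d\<close> (\<open>coboundary_bounded\<close>) and \<open>\<delta>\<close> (\<open>codiff_bounded\<close>).

  The same splitting of the sum shows that \<open>d\<close> and \<open>\<delta>\<close> are adjoint to each other
  (\<open>coboundary_codiff_adjoint\<close>). The term of \<open>d f\<close> that deletes position \<open>j\<close> is first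
  reduced to the one that deletes the last position, by moving entry \<open>j\<close> to the end; the
  sign of this permutation cancels the sign in \<open>d\<close> up to a factor independent of \<open>j\<close>. All the
  sums converge absolutely on square-summable cochains, so symmetry of \<open>D\<close> holds at once
  on the whole space.

  Density comes from the exhaustion by finite sets: restricting a cochain to the
  simplices inside them approximates it by finitely supported ones
  (\<open>dense_cochains_c\<close>).
\<close>

section \<open>Bounded symmetric operators\<close>

text \<open>A subgroup with a definite Hermitian form that is additive in place of linear: this is
  the structure that the parallelogram law uses.\<close>

locale inner_product_carrier =
  fixes H :: "'h::ab_group_add set" and ip :: "'h \<Rightarrow> 'h \<Rightarrow> complex"
  assumes zero_mem: "0 \<in> H"
    and diff_mem: "u \<in> H \<Longrightarrow> v \<in> H \<Longrightarrow> u - v \<in> H"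
    and ip_add_right: "u \<in> H \<Longrightarrow> v \<in> H \<Longrightarrow> w \<in> H \<Longrightarrow> ip u (v + w) = ip u v + ip u w"
    and ip_commute: "u \<in> H \<Longrightarrow> v \<in> H \<Longrightarrow> ip v u = cnj (ip u v)"
    and ip_nonneg: "u \<in> H \<Longrightarrow> 0 \<le> Re (ip u u)"
    and ip_definite: "u \<in> H \<Longrightarrow> Re (ip u u) = 0 \<Longrightarrow> u = 0"
begin

lemma uminus_mem: "u \<in> H \<Longrightarrow> - u \<in> H"
  using diff_mem[OF zero_mem, of u] by simp

lemma add_mem: "u \<in> H \<Longrightarrow> v \<in> H \<Longrightarrow> u + v \<in> H"
  using diff_mem[of u "- v"] uminus_mem by simp

lemma ip_zero_right: "u \<in> H \<Longrightarrow> ip u 0 = 0"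
  using ip_add_right[of u 0 0] zero_mem by simp

lemma ip_diff_right:
  assumes "u \<in> H" "v \<in> H" "w \<in> H"
  shows "ip u (v - w) = ip u v - ip u w"
  using ip_add_right[of u "v - w" w] assms diff_mem by simp

lemma hnorm_sq: "u \<in> H \<Longrightarrow> (hnorm ip u)\<^sup>2 = Re (ip u u)"
  by (simp add: hnorm_def ip_nonneg)

text \<open>The parallelogram law replaces the triangle inequality: it follows from
  additivity and positivity, whereas Cauchy--Schwarz would call for scalar multiplication.\<close>

lemma hnorm_diff_sq_le:
  assumes u: "u \<in> H" and v: "v \<in> H"
  shows "(hnorm ip (u - v))\<^sup>2 \<le> 2 * (hnorm ip u)\<^sup>2 + 2 * (hnorm ip v)\<^sup>2"
proof -
  have mem: "u - v \<in> H" "u + v \<in> H" using u v diff_mem add_mem by auto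
  have "Re (ip (u + v) (u + v)) + Re (ip (u - v) (u - v)) = 2 * Re (ip u u) + 2 * Re (ip v v)"
    using u v mem by (simp add: ip_add_right ip_diff_right ip_commute[of _ "u + v"]
        ip_commute[of _ "u - v"])
  then show ?thesis using ip_nonneg[OF mem(2)] by (simp add: hnorm_sq u v mem)
qed

lemma hlim_unique:
  assumes s: "\<And>k. s k \<in> H" and u: "u \<in> H" and v: "v \<in> H"
    and su: "hlim ip s u" and sv: "hlim ip s v"
  shows "u = v"
proof -
  have lim: "(\<lambda>k. 2 * (hnorm ip (s k - u))\<^sup>2 + 2 * (hnorm ip (s k - v))\<^sup>2) \<longlonglongrightarrow> 2 * 0\<^sup>2 + 2 * 0\<^sup>2"
    using su sv unfolding hlim_def by (intro tendsto_intros)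
  have "(hnorm ip (v - u))\<^sup>2 \<le> 2 * (hnorm ip (s k - u))\<^sup>2 + 2 * (hnorm ip (s k - v))\<^sup>2" for k
    using hnorm_diff_sq_le[of "s k - u" "s k - v"] s u v diff_mem by simp
  then have "(hnorm ip (v - u))\<^sup>2 \<le> 0"
    using LIMSEQ_le_const[OF lim, of "(hnorm ip (v - u))\<^sup>2"] by auto
  then have "Re (ip (v - u) (v - u)) = 0"
    using hnorm_sq[OF diff_mem[OF v u]] ip_nonneg[OF diff_mem[OF v u]] by simp
  then show ?thesis using ip_definite[OF diff_mem[OF v u]] by simp
qed

text \<open>Continuity of \<open>T\<close> and density identify the closure with the graph of \<open>T\<close> on all of
  \<open>H\<close>. For \<open>(y, z)\<close> in the adjoint, symmetry makes \<open>T y - z\<close> orthogonal to all of \<open>H\<close>,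
  itself included.\<close>

lemma essentially_self_adjoint_bounded_symmetric:
  assumes dense: "dense_in H ip A"
    and maps: "\<And>u. u \<in> H \<Longrightarrow> T u \<in> H"
    and diff: "\<And>u v. u \<in> H \<Longrightarrow> v \<in> H \<Longrightarrow> T (u - v) = T u - T v"
    and bounded: "\<And>u. u \<in> H \<Longrightarrow> hnorm ip (T u) \<le> K * hnorm ip u"
    and symmetric: "\<And>u v. u \<in> H \<Longrightarrow> v \<in> H \<Longrightarrow> ip (T u) v = ip u (T v)"
  shows "essentially_self_adjoint H ip A T"
proof -
  have A: "A \<subseteq> H" using dense by (simp add: dense_in_def)
  have continuous: "hlim ip (\<lambda>k. T (s k)) (T u)"
    if "\<And>k. s k \<in> H" "u \<in> H" "hlim ip s u" for s u
  proof -
    have lim: "(\<lambda>k. K * hnorm ip (s k - u)) \<longlonglongrightarrow> 0"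
      using that(3) unfolding hlim_def by (rule tendsto_mult_right_zero)
    have "0 \<le> hnorm ip (T (s k) - T u)" "hnorm ip (T (s k) - T u) \<le> K * hnorm ip (s k - u)" for k
      using that bounded[of "s k - u"] diff[of "s k" u] diff_mem[of "s k" u]
        maps[of "s k - u"] ip_nonneg[of "T (s k - u)"]
      by (simp_all add: hnorm_def)
    then show ?thesis unfolding hlim_def by (intro tendsto_sandwich[OF _ _ tendsto_const lim]) auto
  qed
  have closure: "closure_graph H ip (op_graph A T) = op_graph H T"
  proof (intro equalityI subrelI)
    fix u v assume "(u, v) \<in> closure_graph H ip (op_graph A T)"
    then obtain s t where uv: "u \<in> H" "v \<in> H" and st: "\<And>k. (s k, t k) \<in> op_graph A T"
      and lims: "hlim ip s u" "hlim ip t v"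
      unfolding closure_graph_def by auto
    have s: "s k \<in> H" "t k = T (s k)" for k using st[of k] A by (auto simp: op_graph_def)
    have "hlim ip (\<lambda>k. T (s k)) (T u)" using continuous s uv lims by blast
    moreover have "hlim ip (\<lambda>k. T (s k)) v" using lims(2) by (simp flip: s(2))
    ultimately have "T u = v" using hlim_unique[of "\<lambda>k. T (s k)"] s maps uv by blast
    then show "(u, v) \<in> op_graph H T" using uv by (auto simp: op_graph_def)
  next
    fix u v assume "(u, v) \<in> op_graph H T"
    then have u: "u \<in> H" "v = T u" by (auto simp: op_graph_def)
    obtain s where s: "\<And>k. s k \<in> A" "hlim ip s u" using dense u unfolding dense_in_def by blast
    have "hlim ip (\<lambda>k. T (s k)) v" using continuous[of s u] s u A by blast
    moreover have "(s k, T (s k)) \<in> op_graph A T" for k using s by (auto simp: op_graph_def)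
    ultimately have "\<exists>s t. (\<forall>k. (s k, t k) \<in> op_graph A T) \<and> hlim ip s u \<and> hlim ip t v"
      using s(2) by (intro exI[of _ s] exI[of _ "\<lambda>k. T (s k)"]) simp
    then show "(u, v) \<in> closure_graph H ip (op_graph A T)"
      using u maps by (simp add: closure_graph_def)
  qed
  have adjoint: "adjoint_graph H ip (op_graph H T) = op_graph H T"
  proof (intro equalityI subrelI)
    fix y z assume "(y, z) \<in> adjoint_graph H ip (op_graph H T)"
    then have yz: "y \<in> H" "z \<in> H" and eq: "\<And>u. u \<in> H \<Longrightarrow> ip (T u) y = ip u z"
      by (auto simp: adjoint_graph_def op_graph_def)
    let ?w = "T y - z"
    have w: "?w \<in> H" using yz maps diff_mem by blast
    have "ip ?w ?w = 0"
      using ip_diff_right[OF w, of "T y" z] eq[OF w] symmetric[OF w yz(1)] yz maps by simp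
    then have "T y = z" using ip_definite[OF w] by simp
    then show "(y, z) \<in> op_graph H T" using yz by (auto simp: op_graph_def)
  next
    fix y z assume "(y, z) \<in> op_graph H T"
    then show "(y, z) \<in> adjoint_graph H ip (op_graph H T)"
      using maps symmetric by (auto simp: adjoint_graph_def op_graph_def)
  qed
  have "dense_in H ip H"
  proof -
    have "hlim ip (\<lambda>k. u) u" for u
      using ip_zero_right[OF zero_mem] by (simp add: hlim_def hnorm_def)
    then have "\<exists>s. (\<forall>k. s k \<in> H) \<and> hlim ip s u" if "u \<in> H" for u
      using that by (intro exI[of _ "\<lambda>k. u"]) simp
    then show ?thesis by (simp add: dense_in_def)
  qed
  moreover have "Domain (op_graph H T) = H" "single_valued (op_graph H T)"
    by (auto simp: op_graph_def single_valued_def)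
  ultimately show ?thesis
    unfolding essentially_self_adjoint_def self_adjoint_graph_def closure adjoint
    using dense A maps by auto
qed

end

section \<open>Moving one entry of a tuple to the end\<close>

text \<open>As a permutation of positions this is the cycle sending \<open>j \<mapsto> j + 1 \<mapsto> \<dots> \<mapsto> N \<mapsto> j\<close>; since
  \<open>permute_list p xs\<close> has \<open>xs ! p k\<close> at position \<open>k\<close>, it moves entry \<open>j\<close> of a list to the end.\<close>

definition move_to_end :: "nat \<Rightarrow> nat \<Rightarrow> nat \<Rightarrow> nat" where
  "move_to_end N j k = (if k < j \<or> N < k then k else if k = N then j else Suc k)"

lemma move_to_end_last: "move_to_end N N = id"
  by (auto simp: move_to_end_def fun_eq_iff)

lemma move_to_end_step:
  "j < N \<Longrightarrow> move_to_end N j = Transposition.transpose j (Suc j) \<circ> move_to_end N (Suc j)"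
  by (auto simp: move_to_end_def fun_eq_iff Transposition.transpose_def)

lemma move_to_end_permutes: "j \<le> N \<Longrightarrow> move_to_end N j permutes {..<Suc N}"
proof (induction rule: inc_induct)
  case base
  show ?case by (simp only: move_to_end_last permutes_id)
next
  case (step j)
  then have "Transposition.transpose j (Suc j) permutes {..<Suc N}" by (intro permutes_swap_id) auto
  then show ?case using permutes_compose[OF step.IH] by (simp only: move_to_end_step[OF step.hyps(2)])
qed

lemma sign_move_to_end: "j \<le> N \<Longrightarrow> sign (move_to_end N j) = (- 1) ^ (N - j)"
proof (induction rule: inc_induct)
  case base
  then show ?case by (simp add: move_to_end_last)
next
  case (step j)
  have perm: "permutation (move_to_end N (Suc j))"
    using move_to_end_permutes[of "Suc j" N] step(2) by (auto simp: permutation_permutes)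
  have N: "N - j = Suc (N - Suc j)" using step(2) by simp
  have "sign (move_to_end N j) = - sign (move_to_end N (Suc j))"
    unfolding move_to_end_step[OF step(2)] sign_compose[OF permutation_swap_id perm]
    by (simp add: sign_swap_id)
  then show ?case unfolding N step.IH by simp
qed

lemma permute_list_move_to_end:
  assumes "length xs = Suc N" "j \<le> N"
  shows "permute_list (move_to_end N j) xs = (take j xs @ drop (Suc j) xs) @ [xs ! j]"
proof (rule nth_equalityI)
  fix k assume "k < length (permute_list (move_to_end N j) xs)"
  then have "k \<le> N" using assms by simp
  moreover from this have "k - j < N - j" if "\<not> k < j" "k \<noteq> N" using that by arith
  ultimately show "permute_list (move_to_end N j) xs ! k =
      ((take j xs @ drop (Suc j) xs) @ [xs ! j]) ! k"
    using assms by (cases "k < j"; cases "k = N")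
      (simp_all add: permute_list_def move_to_end_def nth_append)
qed (use assms in simp)

lemma permute_list_snoc:
  assumes "p permutes {..<length xs}"
  shows "permute_list p (xs @ [y]) = permute_list p xs @ [y]"
proof (rule nth_equalityI)
  fix k assume k: "k < length (permute_list p (xs @ [y]))"
  show "permute_list p (xs @ [y]) ! k = (permute_list p xs @ [y]) ! k"
  proof (cases "k < length xs")
    case True
    then have "p k < length xs" using permutes_in_image[OF assms] by auto
    then show ?thesis using True by (simp add: permute_list_def nth_append)
  next
    case False
    then have "k = length xs" "p k = k" using k permutes_not_in[OF assms] by auto
    then show ?thesis by (simp add: permute_list_def nth_append)
  qed
qed simp

text \<open>Deleting position \<open>j\<close> of a permuted tuple permutes the tuple with position \<open>p j\<close>
  deleted. The sign of the induced permutation is read off after moving the deleted entry to the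
  end on both sides: the induced permutation is then the restriction of one that fixes the last
  position.\<close>

lemma permute_list_delete:
  assumes xs: "length xs = Suc N" and p: "p permutes {..<Suc N}" and j: "j \<le> N"
  obtains r where "r permutes {..<N}"
    and "sign r = sign p * (- 1) ^ (N - j) * (- 1) ^ (N - p j)"
    and "take j (permute_list p xs) @ drop (Suc j) (permute_list p xs) =
         permute_list r (take (p j) xs @ drop (Suc (p j)) xs)"
proof -
  define c where "c = move_to_end N j"
  define c' where "c' = move_to_end N (p j)"
  define r where "r = inv c' \<circ> p \<circ> c"
  have pj: "p j \<le> N" using permutes_in_image[OF p, of j] j by auto
  have c: "c permutes {..<Suc N}" and c': "c' permutes {..<Suc N}"
    using move_to_end_permutes j pj by (auto simp: c_def c'_def)
  have r: "r permutes {..<Suc N}"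
    unfolding r_def by (intro permutes_compose c p permutes_inv c')
  have "c N = j" "c' N = p j" using j pj by (auto simp: c_def c'_def move_to_end_def)
  then have "r N = N" using permutes_inv_eq[OF c'] by (simp add: r_def)
  then have rN: "r permutes {..<N}"
    using permutes_superset[OF r, of "{..<N}"] by (auto simp: less_Suc_eq)
  have perm: "permutation c" "permutation c'" "permutation p"
    using c c' p permutation_permutes by blast+
  have "sign r = sign p * (- 1) ^ (N - j) * (- 1) ^ (N - p j)"
    unfolding r_def using perm sign_move_to_end[OF j] sign_move_to_end[OF pj]
    by (simp add: sign_compose permutation_compose permutation_inverse sign_inverse
        flip: c_def c'_def)
  moreover have "take j (permute_list p xs) @ drop (Suc j) (permute_list p xs) =
         permute_list r (take (p j) xs @ drop (Suc (p j)) xs)"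
  proof -
  have "permute_list c (permute_list p xs) = permute_list (c' \<circ> r) xs"
  proof -
    have "c' \<circ> r = p \<circ> c"
      using permutes_surj[OF c'] by (simp add: r_def fun_eq_iff surj_f_inv_f)
    then show ?thesis using permute_list_compose[of c xs p] c xs by simp
  qed
  also have "\<dots> = permute_list r (permute_list c' xs)"
    using permute_list_compose[of r xs c'] r xs by simp
  finally show ?thesis
    using permute_list_move_to_end[of "permute_list p xs" N j] j
      permute_list_move_to_end[OF xs pj] xs pj rN
    by (simp add: permute_list_snoc flip: c_def c'_def append_assoc)
  qed
  ultimately show ?thesis using that rN by blast
qed

section \<open>Simplices\<close>

locale weighted_simplicial_complex =
  fixes V :: "'v set" and m :: "nat \<Rightarrow> 'v list \<Rightarrow> real" and n :: nat
  assumes complex: "weighted_complex V m n" and locally_finite: "locally_finite V m"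
begin

abbreviation "S \<equiv> simplices V m"
abbreviation "N \<equiv> common_neighbours V m"

lemma n_ge_2: "2 \<le> n"
  using complex by (simp add: weighted_complex_def)

lemma adjacent_irrefl: "x \<in> V \<Longrightarrow> \<not> adjacent m x x"
  using complex by (simp add: weighted_complex_def adjacent_def)

lemma weight:
  assumes "i < n" "length xs = i + 1" "set xs \<subseteq> V"
  shows weight_mset: "mset ys = mset xs \<Longrightarrow> m i ys = m i xs"
    and weight_pos_iff: "0 < m i xs \<longleftrightarrow> xs \<in> S i"
  using complex assms unfolding weighted_complex_def by blast+

lemma adjacent_commute: "x \<in> V \<Longrightarrow> y \<in> V \<Longrightarrow> adjacent m x y \<longleftrightarrow> adjacent m y x"
  using weight_mset[of 1 "[x, y]" "[y, x]"] n_ge_2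
  by (simp add: adjacent_def add_mset_commute)

lemma mem_simplices_iff:
  "xs \<in> S i \<longleftrightarrow> length xs = i + 1 \<and> set xs \<subseteq> V \<and> distinct xs \<and>
     (\<forall>x\<in>set xs. \<forall>y\<in>set xs. x \<noteq> y \<longrightarrow> adjacent m x y)"
proof
  assume L: "xs \<in> S i"
  then have len: "length xs = i + 1" "set xs \<subseteq> V"
    and adj: "\<And>a b. a < length xs \<Longrightarrow> b < length xs \<Longrightarrow> a \<noteq> b \<Longrightarrow> adjacent m (xs ! a) (xs ! b)"
    by (simp_all add: simplices_def)
  have "distinct xs"
    unfolding distinct_conv_nth using adj len adjacent_irrefl nth_mem subset_eq by metis
  moreover have "\<forall>x\<in>set xs. \<forall>y\<in>set xs. x \<noteq> y \<longrightarrow> adjacent m x y"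
    using adj by (metis in_set_conv_nth)
  ultimately show "length xs = i + 1 \<and> set xs \<subseteq> V \<and> distinct xs \<and>
     (\<forall>x\<in>set xs. \<forall>y\<in>set xs. x \<noteq> y \<longrightarrow> adjacent m x y)" using len by simp
next
  assume R: "length xs = i + 1 \<and> set xs \<subseteq> V \<and> distinct xs \<and>
     (\<forall>x\<in>set xs. \<forall>y\<in>set xs. x \<noteq> y \<longrightarrow> adjacent m x y)"
  then show "xs \<in> S i" by (auto simp: simplices_def nth_eq_iff_index_eq)
qed

lemma snoc_mem_simplices_iff: "xs @ [y] \<in> S (Suc i) \<longleftrightarrow> xs \<in> S i \<and> y \<in> N xs"
  unfolding mem_simplices_iff common_neighbours_def
  using adjacent_irrefl adjacent_commute by auto

lemma length_simplex: "xs \<in> S i \<Longrightarrow> length xs = Suc i"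
  by (simp add: simplices_def)

lemma weight_pos: "i < n \<Longrightarrow> xs \<in> S i \<Longrightarrow> 0 < m i xs"
  using weight_pos_iff[of i xs] by (simp add: mem_simplices_iff)

lemma mem_simplices_mset: "mset ys = mset xs \<Longrightarrow> ys \<in> S i \<longleftrightarrow> xs \<in> S i"
  unfolding mem_simplices_iff by (metis mset_eq_imp_distinct_iff mset_eq_length mset_eq_setD)

lemma permute_mem_simplices:
  "p permutes {..<Suc i} \<Longrightarrow> length xs = Suc i \<Longrightarrow> permute_list p xs \<in> S i \<longleftrightarrow> xs \<in> S i"
  using mem_simplices_mset[OF mset_permute_list] by simp

lemma weight_permute:
  "i < n \<Longrightarrow> xs \<in> S i \<Longrightarrow> p permutes {..<Suc i} \<Longrightarrow> m i (permute_list p xs) = m i xs"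
  by (rule weight_mset) (simp_all add: mem_simplices_iff)

lemma bij_betw_permute_list:
  assumes p: "p permutes {..<Suc i}"
  shows "bij_betw (permute_list p) (S i) (S i)"
proof (rule bij_betw_byWitness[where f' = "permute_list (inv p)"])
  have q: "inv p permutes {..<Suc i}" using p by (rule permutes_inv)
  show "\<forall>xs\<in>S i. permute_list (inv p) (permute_list p xs) = xs"
    using q p by (auto simp: permutes_inv_o length_simplex simp flip: permute_list_compose)
  show "\<forall>xs\<in>S i. permute_list p (permute_list (inv p) xs) = xs"
    using q p by (auto simp: permutes_inv_o length_simplex simp flip: permute_list_compose)
  show "permute_list p ` S i \<subseteq> S i" "permute_list (inv p) ` S i \<subseteq> S i"
    using p q by (auto simp: permute_mem_simplices length_simplex)
qed

lemma finite_common_neighbours: "xs \<in> S i \<Longrightarrow> finite (N xs)"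
proof -
  assume xs: "xs \<in> S i"
  then have "hd xs \<in> set xs" "set xs \<subseteq> V" by (cases xs; auto simp: mem_simplices_iff)+
  then have "finite {y \<in> V. adjacent m (hd xs) y}" "N xs \<subseteq> {y \<in> V. adjacent m (hd xs) y}"
    using locally_finite by (auto simp: locally_finite_def common_neighbours_def)
  then show ?thesis by (rule rev_finite_subset)
qed

text \<open>This bijection turns sums over simplices into iterated sums whose inner sums are
  finite by local finiteness.\<close>

lemma bij_betw_snoc: "bij_betw (\<lambda>(xs, y). xs @ [y]) (Sigma (S i) N) (S (Suc i))"
proof (rule bij_betw_byWitness[where f' = "\<lambda>zs. (butlast zs, last zs)"])
  have *: "zs = butlast zs @ [last zs]" if "zs \<in> S (Suc i)" for zs
    using length_simplex[OF that] by (metis append_butlast_last_id list.size(3) nat.distinct(1))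
  show "\<forall>zs\<in>S (Suc i). (case (butlast zs, last zs) of (xs, y) \<Rightarrow> xs @ [y]) = zs"
    using * by auto
  show "(\<lambda>zs. (butlast zs, last zs)) ` S (Suc i) \<subseteq> Sigma (S i) N"
    using * snoc_mem_simplices_iff by (auto; metis)
qed (auto simp: snoc_mem_simplices_iff)

lemma summable_on_snoc:
  fixes h :: "'v list \<Rightarrow> complex"
  assumes "h summable_on S (Suc i)"
  shows "(\<lambda>xs. \<Sum>y\<in>N xs. h (xs @ [y])) summable_on S i"
    and "infsum h (S (Suc i)) = (\<Sum>\<^sub>\<infinity>xs\<in>S i. \<Sum>y\<in>N xs. h (xs @ [y]))"
proof -
  have sum: "(\<lambda>(xs, y). h (xs @ [y])) summable_on Sigma (S i) N"
    using summable_on_reindex_bij_betw[OF bij_betw_snoc, of h i] assms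
    by (simp add: case_prod_unfold)
  have fin: "infsum (\<lambda>y. h (xs @ [y])) (N xs) = (\<Sum>y\<in>N xs. h (xs @ [y]))" if "xs \<in> S i" for xs
    using finite_common_neighbours[OF that] by simp
  show "(\<lambda>xs. \<Sum>y\<in>N xs. h (xs @ [y])) summable_on S i"
    using summable_on_Sigma_banach[OF sum] fin by (simp cong: summable_on_cong)
  have "infsum h (S (Suc i)) = infsum (\<lambda>(xs, y). h (xs @ [y])) (Sigma (S i) N)"
    using infsum_reindex_bij_betw[OF bij_betw_snoc, of h i] by (simp add: case_prod_unfold)
  also have "\<dots> = (\<Sum>\<^sub>\<infinity>xs\<in>S i. \<Sum>y\<in>N xs. h (xs @ [y]))"
    using infsum_Sigma'_banach[OF sum] fin by (simp cong: infsum_cong)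
  finally show "infsum h (S (Suc i)) = (\<Sum>\<^sub>\<infinity>xs\<in>S i. \<Sum>y\<in>N xs. h (xs @ [y]))" .
qed

text \<open>For nonnegative terms summability transfers in both directions, which allows
  summability on the larger simplices to be derived from that on their faces.\<close>

lemma has_sum_snoc_nonneg:
  fixes h :: "'v list \<Rightarrow> real"
  assumes nonneg: "\<And>xs. xs \<in> S (Suc i) \<Longrightarrow> 0 \<le> h xs"
  shows "(h has_sum s) (S (Suc i)) \<longleftrightarrow> ((\<lambda>xs. \<Sum>y\<in>N xs. h (xs @ [y])) has_sum s) (S i)"
proof -
  let ?h = "\<lambda>(xs, y). h (xs @ [y])"
  have fin: "((\<lambda>y. ?h (xs, y)) has_sum (\<Sum>y\<in>N xs. h (xs @ [y]))) (N xs)" if "xs \<in> S i" for xs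
    using finite_common_neighbours[OF that] by simp
  have "(h has_sum s) (S (Suc i)) \<longleftrightarrow> (?h has_sum s) (Sigma (S i) N)"
    using has_sum_reindex_bij_betw[OF bij_betw_snoc, of h i s] by (simp add: case_prod_unfold)
  also have "\<dots> \<longleftrightarrow> ((\<lambda>xs. \<Sum>y\<in>N xs. h (xs @ [y])) has_sum s) (S i)"
  proof
    assume "(?h has_sum s) (Sigma (S i) N)"
    then show "((\<lambda>xs. \<Sum>y\<in>N xs. h (xs @ [y])) has_sum s) (S i)"
      by (rule has_sum_SigmaD[OF _ fin])
  next
    assume R: "((\<lambda>xs. \<Sum>y\<in>N xs. h (xs @ [y])) has_sum s) (S i)"
    have "?h summable_on Sigma (S i) N"
      by (rule summable_on_SigmaI[OF fin])
        (use R nonneg in \<open>auto simp: summable_on_def snoc_mem_simplices_iff\<close>)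
    then show "(?h has_sum s) (Sigma (S i) N)" using has_sum_SigmaI[OF fin R] by blast
  qed
  finally show ?thesis .
qed

end

section \<open>The coboundary and the codifferential are bounded\<close>

text \<open>Combines the sign of a permutation induced by deleting a position with the sign of the
  deleted term in the coboundary.\<close>

lemma minus_one_power_deletion:
  fixes N j k :: nat
  assumes "j \<le> N" "k \<le> N"
  shows "(- 1) ^ j * ((- 1) ^ (N - j) * (- 1) ^ (N - k)) = ((- 1) ^ k :: complex)"
  using assms by (auto simp: minus_one_power_iff)

lemma has_sum_finite_sum:
  fixes f :: "'i \<Rightarrow> 'a \<Rightarrow> 'b::topological_comm_monoid_add"
  assumes "finite I" "\<And>i. i \<in> I \<Longrightarrow> (f i has_sum s i) A"
  shows "((\<lambda>x. \<Sum>i\<in>I. f i x) has_sum (\<Sum>i\<in>I. s i)) A"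
  using assms by (induction I rule: finite_induct) (auto intro: has_sum_add)

context weighted_simplicial_complex
begin

abbreviation "L2 \<equiv> cochains_l2 V m"

lemma delete_mem_simplices:
  assumes xs: "xs \<in> S (Suc i)" and j: "j \<le> Suc i"
  shows "take j xs @ drop (Suc j) xs \<in> S i"
  using permute_mem_simplices[OF move_to_end_permutes[OF j]] length_simplex[OF xs] xs
    permute_list_move_to_end[of xs "Suc i" j] j snoc_mem_simplices_iff by metis

text \<open>Permuting the vertices by \<open>p\<close> turns the term that deletes position \<open>j\<close> into \<open>sign p\<close>
  times the term that deletes position \<open>p j\<close>, so the sum over \<open>j\<close> is merely rearranged.\<close>

lemma alternating_coboundary:
  assumes f: "alternating_cochain V m i f"
  shows "alternating_cochain V m (Suc i) (coboundary V m i f)"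
  unfolding alternating_cochain_def
proof (intro conjI allI ballI impI)
  fix xs p assume xs: "xs \<in> S (Suc i)" and "p permutes {..<length xs}"
  let ?N = "Suc i" and ?del = "\<lambda>j xs. take j xs @ drop (Suc j) xs"
  have len: "length xs = Suc ?N" using length_simplex[OF xs] .
  then have p: "p permutes {..<Suc ?N}" using \<open>p permutes {..<length xs}\<close> by simp
  have summand: "(- 1) ^ j * f (?del j (permute_list p xs)) =
      of_int (sign p) * ((- 1) ^ p j * f (?del (p j) xs))" if j: "j \<le> ?N" for j
  proof -
    have pj: "p j \<le> ?N" using permutes_in_image[OF p, of j] j by auto
    obtain r where r: "r permutes {..<?N}"
      and sgn: "sign r = sign p * (- 1) ^ (?N - j) * (- 1) ^ (?N - p j)"
      and eq: "?del j (permute_list p xs) = permute_list r (?del (p j) xs)"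
      using permute_list_delete[OF len p j] .
    have mem: "?del (p j) xs \<in> S i" using delete_mem_simplices[OF xs pj] .
    have "f (?del j (permute_list p xs)) = of_int (sign r) * f (?del (p j) xs)"
      using f mem r length_simplex[OF mem] unfolding eq alternating_cochain_def by simp
    then have "(- 1) ^ j * f (?del j (permute_list p xs)) =
        of_int (sign p) * (((- 1) ^ j * ((- 1) ^ (?N - j) * (- 1) ^ (?N - p j))) * f (?del (p j) xs))"
      by (simp add: sgn mult_ac del: power_Suc)
    then show ?thesis unfolding minus_one_power_deletion[OF j pj] .
  qed
  have "coboundary V m i f (permute_list p xs) =
      (\<Sum>j\<le>?N. (- 1) ^ j * f (?del j (permute_list p xs)))"
    using permute_mem_simplices[OF p len] xs by (simp add: coboundary_def)
  also have "\<dots> = (\<Sum>j\<le>?N. of_int (sign p) * ((- 1) ^ p j * f (?del (p j) xs)))"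
    using summand by (intro sum.cong) auto
  also have "\<dots> = (\<Sum>j\<le>?N. of_int (sign p) * ((- 1) ^ j * f (?del j xs)))"
    using sum.reindex_bij_betw[OF permutes_imp_bij[OF p]] by (simp only: lessThan_Suc_atMost)
  also have "\<dots> = of_int (sign p) * coboundary V m i f xs"
    using xs by (simp add: coboundary_def sum_distrib_left del: sum.atMost_Suc)
  finally show "coboundary V m i f (permute_list p xs) = of_int (sign p) * coboundary V m i f xs" .
qed (simp add: coboundary_def)

lemma alternating_codiff:
  assumes g: "alternating_cochain V m (Suc i) g" and i: "Suc i < n"
  shows "alternating_cochain V m i (codiff V m (Suc i) g)"
  unfolding alternating_cochain_def
proof (intro conjI allI ballI impI)
  fix xs p assume xs: "xs \<in> S i" and p: "p permutes {..<length xs}"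
  have len: "length xs = Suc i" using length_simplex[OF xs] .
  have p': "p permutes {..<Suc (Suc i)}" using p len by (auto intro: permutes_subset)
  have N: "N (permute_list p xs) = N xs"
    using p by (simp add: common_neighbours_def)
  have "of_real (m (Suc i) (permute_list p xs @ [y])) * g (permute_list p xs @ [y]) =
      of_int (sign p) * (of_real (m (Suc i) (xs @ [y])) * g (xs @ [y]))" if y: "y \<in> N xs" for y
  proof -
    have zs: "xs @ [y] \<in> S (Suc i)" using xs y by (simp add: snoc_mem_simplices_iff)
    have eq: "permute_list p xs @ [y] = permute_list p (xs @ [y])"
      using permute_list_snoc[OF p] by simp
    have "g (permute_list p (xs @ [y])) = of_int (sign p) * g (xs @ [y])"
      using g zs p' len unfolding alternating_cochain_def by simp
    then show ?thesis unfolding eq using weight_permute[OF i zs p'] by simp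
  qed
  then have "(\<Sum>y\<in>N xs. of_real (m (Suc i) (permute_list p xs @ [y])) * g (permute_list p xs @ [y])) =
      of_int (sign p) * (\<Sum>y\<in>N xs. of_real (m (Suc i) (xs @ [y])) * g (xs @ [y]))"
    by (simp add: sum_distrib_left)
  then show "codiff V m (Suc i) g (permute_list p xs) = of_int (sign p) * codiff V m (Suc i) g xs"
    using xs p len i weight_permute[of i xs p] permute_mem_simplices[of p i xs]
    by (simp add: codiff_def N)
qed (simp add: codiff_def)

text \<open>The squared \<open>\<ell>\<^sup>2\<close> norm times \<open>(i + 1)!\<close>. Leaving the normalising factorial out keeps the
  estimates between neighbouring levels free of extra constants.\<close>

definition sqsum :: "nat \<Rightarrow> ('v list \<Rightarrow> complex) \<Rightarrow> real" where
  "sqsum i f = (\<Sum>\<^sub>\<infinity>xs\<in>S i. m i xs * (cmod (f xs))\<^sup>2)"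

lemma weight_nonneg: "i < n \<Longrightarrow> xs \<in> S i \<Longrightarrow> 0 \<le> m i xs"
  using weight_pos by (simp add: less_imp_le)

lemma sqsum_nonneg: "i < n \<Longrightarrow> 0 \<le> sqsum i f"
  unfolding sqsum_def by (intro infsum_nonneg) (simp add: weight_nonneg)

lemma L2_has_sum: "f \<in> L2 i \<Longrightarrow> ((\<lambda>xs. m i xs * (cmod (f xs))\<^sup>2) has_sum sqsum i f) (S i)"
  unfolding sqsum_def cochains_l2_def by (intro has_sum_infsum) simp

lemma L2_alternating: "f \<in> L2 i \<Longrightarrow> alternating_cochain V m i f"
  by (simp add: cochains_l2_def)

lemma L2_comparison:
  assumes "alternating_cochain V m i f" "i < n"
    and "(h has_sum s) (S i)" "\<And>xs. xs \<in> S i \<Longrightarrow> m i xs * (cmod (f xs))\<^sup>2 \<le> h xs"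
  shows "f \<in> L2 i" and "sqsum i f \<le> s"
proof -
  have "(\<lambda>xs. m i xs * (cmod (f xs))\<^sup>2) summable_on S i"
    using weight_nonneg[OF assms(2)]
    by (intro summable_on_comparison_test[OF has_sum_imp_summable[OF assms(3)] assms(4)]) auto
  then show f: "f \<in> L2 i" using assms(1) by (simp add: cochains_l2_def)
  show "sqsum i f \<le> s" using has_sum_mono[OF L2_has_sum[OF f] assms(3)] assms(4) by blast
qed

lemma weighted_degree_eq:
  assumes "xs \<in> S i" "Suc i < n"
  shows "(\<Sum>y\<in>N xs. m (Suc i) (xs @ [y])) = m i xs * weighted_degree V m i xs"
  using weight_pos[of i xs] assms by (simp add: weighted_degree_def)

end

locale bounded_degree_complex = weighted_simplicial_complex V m n
  for V :: "'v set" and m n +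
  fixes K :: real
  assumes weighted_degree_le: "Suc i < n \<Longrightarrow> xs \<in> S i \<Longrightarrow> weighted_degree V m i xs \<le> K"
    and K_nonneg: "0 \<le> K"
begin

text \<open>Summing over the last vertex leaves \<open>\<phi>\<close> on the face, weighted by \<open>m\<^sub>i\<close> times the
  weighted degree, and the degree bound applies.\<close>

lemma has_sum_extension:
  fixes \<phi> :: "'v list \<Rightarrow> real"
  assumes i: "Suc i < n" and nonneg: "\<And>xs. 0 \<le> \<phi> xs"
    and sum: "((\<lambda>xs. m i xs * \<phi> xs) has_sum s) (S i)"
  obtains t where "((\<lambda>zs. m (Suc i) zs * \<phi> (butlast zs)) has_sum t) (S (Suc i))" "t \<le> K * s"
proof -
  let ?g = "\<lambda>xs. \<Sum>y\<in>N xs. m (Suc i) (xs @ [y]) * \<phi> (butlast (xs @ [y]))"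
  have eq: "?g xs = (\<Sum>y\<in>N xs. m (Suc i) (xs @ [y])) * \<phi> xs" for xs
    by (simp add: sum_distrib_right)
  have le: "?g xs \<le> K * (m i xs * \<phi> xs)" if xs: "xs \<in> S i" for xs
  proof -
    have "?g xs = weighted_degree V m i xs * (m i xs * \<phi> xs)"
      unfolding eq weighted_degree_eq[OF xs i] by simp
    then show ?thesis
      using weighted_degree_le[OF i xs] weight_nonneg[of i xs] i xs nonneg
      by (simp add: mult_right_mono)
  qed
  have g0: "0 \<le> ?g xs" if "xs \<in> S i" for xs
    using weight_nonneg[OF i] nonneg that by (intro sum_nonneg) (simp add: snoc_mem_simplices_iff)
  have K: "((\<lambda>xs. K * (m i xs * \<phi> xs)) has_sum K * s) (S i)" using sum by (rule has_sum_cmult_right)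
  have "?g summable_on S i"
    by (rule summable_on_comparison_test[OF has_sum_imp_summable[OF K] le g0])
  then have g: "(?g has_sum infsum ?g (S i)) (S i)" by (rule has_sum_infsum)
  then have "((\<lambda>zs. m (Suc i) zs * \<phi> (butlast zs)) has_sum infsum ?g (S i)) (S (Suc i))"
    by (subst has_sum_snoc_nonneg) (simp_all add: weight_nonneg[OF i] nonneg)
  moreover have "infsum ?g (S i) \<le> K * s" using has_sum_mono[OF g K] le by blast
  ultimately show ?thesis using that by blast
qed

lemma coboundary_eq:
  assumes "xs \<in> S (Suc i)"
  shows "coboundary V m i f xs =
    (\<Sum>j\<le>Suc i. (- 1) ^ j * f (butlast (permute_list (move_to_end (Suc i) j) xs)))"
proof -
  have "take j xs @ drop (Suc j) xs = butlast (permute_list (move_to_end (Suc i) j) xs)"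
    if "j \<le> Suc i" for j
    by (simp only: permute_list_move_to_end[OF length_simplex[OF assms] that] butlast_snoc)
  then show ?thesis using assms by (simp add: coboundary_def)
qed

text \<open>Each of the \<open>i + 2\<close> faces contributes the same sum, because moving the deleted vertex to
  the end permutes the simplices and preserves the weights; the other factor \<open>i + 2\<close> comes
  from Cauchy--Schwarz for the square of a sum of \<open>i + 2\<close> terms.\<close>

lemma coboundary_bounded:
  assumes f: "f \<in> L2 i" and i: "Suc i < n"
  shows "coboundary V m i f \<in> L2 (Suc i)"
    and "sqsum (Suc i) (coboundary V m i f) \<le> (real i + 2)\<^sup>2 * K * sqsum i f"
proof -
  let ?c = "move_to_end (Suc i)"
  obtain t where t: "((\<lambda>zs. m (Suc i) zs * (cmod (f (butlast zs)))\<^sup>2) has_sum t) (S (Suc i))"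
      "t \<le> K * sqsum i f"
    using has_sum_extension[OF i _ L2_has_sum[OF f]] by auto
  let ?h = "\<lambda>j xs. m (Suc i) xs * (cmod (f (butlast (permute_list (?c j) xs))))\<^sup>2"
  have "(?h j has_sum t) (S (Suc i))" if j: "j \<le> Suc i" for j
  proof -
    have p: "?c j permutes {..<Suc (Suc i)}" using move_to_end_permutes[OF j] .
    have "((\<lambda>xs. m (Suc i) (permute_list (?c j) xs) *
        (cmod (f (butlast (permute_list (?c j) xs))))\<^sup>2) has_sum t) (S (Suc i))"
      using t(1) by (subst has_sum_reindex_bij_betw[OF bij_betw_permute_list[OF p]])
    then show ?thesis using weight_permute[OF i _ p] by (simp cong: has_sum_cong)
  qed
  then have "((\<lambda>xs. \<Sum>j\<le>Suc i. ?h j xs) has_sum (\<Sum>j\<le>Suc i. t)) (S (Suc i))"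
    by (intro has_sum_finite_sum) auto
  then have "((\<lambda>xs. (real i + 2) * (\<Sum>j\<le>Suc i. ?h j xs)) has_sum
      ((real i + 2) * (\<Sum>j\<le>Suc i. t))) (S (Suc i))"
    by (rule has_sum_cmult_right)
  moreover have "m (Suc i) xs * (cmod (coboundary V m i f xs))\<^sup>2 \<le>
      (real i + 2) * (\<Sum>j\<le>Suc i. ?h j xs)" if xs: "xs \<in> S (Suc i)" for xs
  proof -
    let ?a = "\<lambda>j. cmod (f (butlast (permute_list (?c j) xs)))"
    have "cmod (coboundary V m i f xs) \<le> (\<Sum>j\<le>Suc i. ?a j)"
      unfolding coboundary_eq[OF xs] by (rule order_trans[OF norm_sum]) (simp add: norm_mult norm_power)
    then have "(cmod (coboundary V m i f xs))\<^sup>2 \<le> (\<Sum>j\<le>Suc i. ?a j)\<^sup>2"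
      by (intro power_mono) auto
    also have "\<dots> \<le> (\<Sum>j\<le>Suc i. (?a j)\<^sup>2) * (real i + 2)"
      using sum_squared_le_sum_of_squares[of ?a "{..Suc i}"] by (simp add: add_ac)
    finally have "m (Suc i) xs * (cmod (coboundary V m i f xs))\<^sup>2 \<le>
        m (Suc i) xs * ((\<Sum>j\<le>Suc i. (?a j)\<^sup>2) * (real i + 2))"
      using weight_nonneg[OF i xs] by (intro mult_left_mono)
    then show ?thesis by (simp only: sum_distrib_left mult_ac)
  qed
  ultimately have "coboundary V m i f \<in> L2 (Suc i)"
    and le: "sqsum (Suc i) (coboundary V m i f) \<le> (real i + 2) * (\<Sum>j\<le>Suc i. t)"
    using L2_comparison[OF alternating_coboundary[OF L2_alternating[OF f]] i] by blast+
  then show "coboundary V m i f \<in> L2 (Suc i)" by simp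
  have "(real i + 2) * (\<Sum>j\<le>Suc i. t) = (real i + 2)\<^sup>2 * t" by (simp add: power2_eq_square algebra_simps)
  also have "\<dots> \<le> (real i + 2)\<^sup>2 * (K * sqsum i f)" using t(2) by (intro mult_left_mono) auto
  finally show "sqsum (Suc i) (coboundary V m i f) \<le> (real i + 2)\<^sup>2 * K * sqsum i f"
    using le by (simp add: mult.assoc)
qed

text \<open>Cauchy--Schwarz with respect to the weights \<open>m\<^sub>i\<^sub>+\<^sub>1\<close> on the common neighbours bounds
  \<open>m\<^sub>i |\<delta> g|\<^sup>2\<close> by the weighted degree times the sum of \<open>m\<^sub>i\<^sub>+\<^sub>1 |g|\<^sup>2\<close> over the extensions of a
  simplex.\<close>

lemma codiff_bounded:
  assumes g: "g \<in> L2 (Suc i)" and i: "Suc i < n"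
  shows "codiff V m (Suc i) g \<in> L2 i"
    and "sqsum i (codiff V m (Suc i) g) \<le> K * sqsum (Suc i) g"
proof -
  let ?s = "\<lambda>xs. \<Sum>y\<in>N xs. m (Suc i) (xs @ [y]) * (cmod (g (xs @ [y])))\<^sup>2"
  have "(?s has_sum sqsum (Suc i) g) (S i)"
    using L2_has_sum[OF g] by (subst (asm) has_sum_snoc_nonneg) (simp_all add: weight_nonneg[OF i])
  then have "((\<lambda>xs. K * ?s xs) has_sum K * sqsum (Suc i) g) (S i)" by (rule has_sum_cmult_right)
  moreover have "m i xs * (cmod (codiff V m (Suc i) g xs))\<^sup>2 \<le> K * ?s xs" if xs: "xs \<in> S i" for xs
  proof -
    have pos: "0 < m i xs" using weight_pos[of i xs] i xs by simp
    have w: "0 \<le> m (Suc i) (xs @ [y])" if "y \<in> N xs" for y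
      using weight_nonneg[OF i] xs that by (simp add: snoc_mem_simplices_iff)
    let ?A = "\<Sum>y\<in>N xs. m (Suc i) (xs @ [y])"
    let ?z = "\<Sum>y\<in>N xs. of_real (m (Suc i) (xs @ [y])) * g (xs @ [y])"
    \<comment> \<open>The weight is split into two square roots to match the Cauchy--Schwarz inequality.\<close>
    have "cmod ?z \<le> (\<Sum>y\<in>N xs. sqrt (m (Suc i) (xs @ [y])) *
        (sqrt (m (Suc i) (xs @ [y])) * cmod (g (xs @ [y]))))"
      using w by (intro order_trans[OF norm_sum] sum_mono) (simp add: norm_mult flip: mult.assoc)
    then have "(cmod ?z)\<^sup>2 \<le> (\<Sum>y\<in>N xs. sqrt (m (Suc i) (xs @ [y])) *
        (sqrt (m (Suc i) (xs @ [y])) * cmod (g (xs @ [y]))))\<^sup>2"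
      by (intro power_mono) auto
    also have "\<dots> \<le> (\<Sum>y\<in>N xs. (sqrt (m (Suc i) (xs @ [y])))\<^sup>2) *
        (\<Sum>y\<in>N xs. (sqrt (m (Suc i) (xs @ [y])) * cmod (g (xs @ [y])))\<^sup>2)"
      by (rule Cauchy_Schwarz_ineq_sum)
    also have "\<dots> = ?A * ?s xs" using w by (simp add: power_mult_distrib)
    finally have z: "(cmod ?z)\<^sup>2 \<le> m i xs * weighted_degree V m i xs * ?s xs"
      unfolding weighted_degree_eq[OF xs i] .
    have "m i xs * (cmod (codiff V m (Suc i) g xs))\<^sup>2 = (cmod ?z)\<^sup>2 / m i xs"
      using xs pos by (simp add: codiff_def norm_mult norm_divide norm_power power_mult_distrib
          power_divide power2_eq_square)
    also have "\<dots> \<le> weighted_degree V m i xs * ?s xs"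
      using z pos by (simp add: field_simps)
    also have "\<dots> \<le> K * ?s xs"
      using weighted_degree_le[OF i xs] w by (intro mult_right_mono sum_nonneg) auto
    finally show ?thesis .
  qed
  ultimately show "codiff V m (Suc i) g \<in> L2 i"
    and "sqsum i (codiff V m (Suc i) g) \<le> K * sqsum (Suc i) g"
    using L2_comparison[OF alternating_codiff[OF L2_alternating[OF g] i]] i by auto
qed

end

context weighted_simplicial_complex
begin

section \<open>The Hilbert space of square-summable cochains\<close>

abbreviation "ip_at \<equiv> inner_l2 V m"

text \<open>Stated for functions that need not be alternating, since it is also applied to
  \<open>zs \<mapsto> f (butlast zs)\<close>. The bound is \<open>|f| |g| \<le> |f|\<^sup>2 + |g|\<^sup>2\<close>.\<close>

lemma weighted_product_summable:
  fixes f g :: "'v list \<Rightarrow> complex"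
  assumes i: "i < n"
    and f: "(\<lambda>xs. m i xs * (cmod (f xs))\<^sup>2) summable_on S i"
    and g: "(\<lambda>xs. m i xs * (cmod (g xs))\<^sup>2) summable_on S i"
  shows "(\<lambda>xs. complex_of_real (m i xs) * cnj (f xs) * g xs) summable_on S i"
proof (rule abs_summable_summable,
    rule Infinite_Sum.abs_summable_on_comparison_test'[OF summable_on_add[OF f g]])
  fix xs assume xs: "xs \<in> S i"
  have "cmod (f xs) * cmod (g xs) \<le> (cmod (f xs))\<^sup>2 + (cmod (g xs))\<^sup>2"
    using sum_squares_bound[of "cmod (f xs)" "cmod (g xs)"]
      mult_nonneg_nonneg[OF norm_ge_zero[of "f xs"] norm_ge_zero[of "g xs"]] by linarith
  then have "m i xs * (cmod (f xs) * cmod (g xs)) \<le> m i xs * ((cmod (f xs))\<^sup>2 + (cmod (g xs))\<^sup>2)"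
    using weight_nonneg[OF i xs] by (rule mult_left_mono)
  then show "norm (complex_of_real (m i xs) * cnj (f xs) * g xs) \<le>
      m i xs * (cmod (f xs))\<^sup>2 + m i xs * (cmod (g xs))\<^sup>2"
    using weight_nonneg[OF i xs] by (simp add: norm_mult mult.assoc distrib_left)
qed

lemma inner_summable:
  assumes "f \<in> L2 i" "g \<in> L2 i" "i < n"
  shows "(\<lambda>xs. complex_of_real (m i xs) * cnj (f xs) * g xs) summable_on S i"
  using assms by (intro weighted_product_summable) (simp_all add: cochains_l2_def)

lemma L2_zero: "0 \<in> L2 i"
  by (simp add: cochains_l2_def alternating_cochain_def)

lemma L2_uminus: "f \<in> L2 i \<Longrightarrow> - f \<in> L2 i"
  by (simp add: cochains_l2_def alternating_cochain_def)

lemma L2_add: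
  assumes f: "f \<in> L2 i" and g: "g \<in> L2 i" and i: "i < n"
  shows "f + g \<in> L2 i" and "sqsum i (f + g) \<le> 2 * sqsum i f + 2 * sqsum i g"
proof -
  have alt: "alternating_cochain V m i (f + g)"
    using f g by (simp add: cochains_l2_def alternating_cochain_def distrib_left)
  have sum: "((\<lambda>xs. 2 * (m i xs * (cmod (f xs))\<^sup>2) + 2 * (m i xs * (cmod (g xs))\<^sup>2)) has_sum
      2 * sqsum i f + 2 * sqsum i g) (S i)"
    using f g by (intro has_sum_add has_sum_cmult_right L2_has_sum)
  have le: "m i xs * (cmod ((f + g) xs))\<^sup>2 \<le>
      2 * (m i xs * (cmod (f xs))\<^sup>2) + 2 * (m i xs * (cmod (g xs))\<^sup>2)" if xs: "xs \<in> S i" for xs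
  proof -
    have "(cmod (f xs + g xs))\<^sup>2 \<le> (cmod (f xs) + cmod (g xs))\<^sup>2"
      by (intro power_mono norm_triangle_ineq) auto
    also have "\<dots> \<le> 2 * (cmod (f xs))\<^sup>2 + 2 * (cmod (g xs))\<^sup>2"
      using sum_squares_bound[of "cmod (f xs)" "cmod (g xs)"] by (simp add: power2_sum)
    finally have "m i xs * (cmod (f xs + g xs))\<^sup>2 \<le>
        m i xs * (2 * (cmod (f xs))\<^sup>2 + 2 * (cmod (g xs))\<^sup>2)"
      using weight_nonneg[OF i xs] by (rule mult_left_mono)
    then show ?thesis by (simp add: distrib_left mult.left_commute)
  qed
  show "f + g \<in> L2 i" and "sqsum i (f + g) \<le> 2 * sqsum i f + 2 * sqsum i g"
    using L2_comparison[OF alt i sum le] by blast+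
qed

lemma ip_at_add_right:
  assumes "f \<in> L2 i" "g \<in> L2 i" "h \<in> L2 i" "i < n"
  shows "ip_at i f (g + h) = ip_at i f g + ip_at i f h"
  using infsum_add[OF inner_summable[OF assms(1,2,4)] inner_summable[OF assms(1,3,4)]]
  by (simp add: inner_l2_def distrib_left add_divide_distrib)

lemma inner_commute: "ip_at i g f = cnj (ip_at i f g)"
  by (simp add: inner_l2_def mult_ac flip: infsum_cnj)

lemma inner_self:
  assumes "f \<in> L2 i"
  shows "ip_at i f f = of_real (sqsum i f / fact (i + 1))"
proof -
  have "((\<lambda>xs. complex_of_real (m i xs * (cmod (f xs))\<^sup>2)) has_sum of_real (sqsum i f)) (S i)"
    using L2_has_sum[OF assms] by (rule has_sum_of_real)
  also have "(\<lambda>xs. complex_of_real (m i xs * (cmod (f xs))\<^sup>2)) =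
      (\<lambda>xs. complex_of_real (m i xs) * cnj (f xs) * f xs)"
    by (simp only: of_real_mult complex_norm_square mult_ac)
  finally show ?thesis by (simp add: inner_l2_def infsumI)
qed

lemma sqsum_eq_0:
  assumes f: "f \<in> L2 i" and i: "i < n" and 0: "sqsum i f = 0"
  shows "f = 0"
proof
  fix xs
  show "f xs = 0 xs"
  proof (cases "xs \<in> S i")
    case True
    have "m i xs * (cmod (f xs))\<^sup>2 = 0"
      using nonneg_has_sum_le_0D[OF L2_has_sum[OF f] _ _ True] 0 weight_nonneg[OF i] by simp
    then show ?thesis using weight_pos[OF i True] by simp
  next
    case False
    then show ?thesis using L2_alternating[OF f] by (simp add: alternating_cochain_def)
  qed
qed

abbreviation "H \<equiv> direct_sum n L2"
abbreviation "ip \<equiv> inner_sum V m n"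

lemma direct_sum_D: "F \<in> H \<Longrightarrow> i < n \<Longrightarrow> F i \<in> L2 i"
  by (simp add: direct_sum_def)

lemma Re_ip_self: "F \<in> H \<Longrightarrow> Re (ip F F) = (\<Sum>i<n. sqsum i (F i) / fact (i + 1))"
  unfolding inner_sum_def Re_sum
  by (intro sum.cong) (simp_all only: inner_self direct_sum_D lessThan_iff Re_complex_of_real)

lemma inner_product_carrier_H: "inner_product_carrier H ip"
proof
  show "0 \<in> H" by (simp add: direct_sum_def L2_zero)
next
  fix u v assume uv: "u \<in> H" "v \<in> H"
  then show "u - v \<in> H"
    using L2_add(1)[OF _ L2_uminus] by (simp add: direct_sum_def)
  show "ip v u = cnj (ip u v)"
    unfolding inner_sum_def cnj_sum by (intro sum.cong inner_commute) simp
next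
  fix u v w assume "u \<in> H" "v \<in> H" "w \<in> H"
  then show "ip u (v + w) = ip u v + ip u w"
    unfolding inner_sum_def by (simp add: ip_at_add_right direct_sum_D flip: sum.distrib)
next
  fix u assume u: "u \<in> H"
  have nonneg: "0 \<le> sqsum i (u i) / fact (i + 1)" if "i < n" for i
    using sqsum_nonneg[OF that] by simp
  show "0 \<le> Re (ip u u)" unfolding Re_ip_self[OF u] using nonneg by (intro sum_nonneg) simp
  assume "Re (ip u u) = 0"
  then have "(\<Sum>i<n. sqsum i (u i) / fact (i + 1)) = 0" by (simp add: Re_ip_self[OF u])
  then have "sqsum i (u i) = 0" if "i < n" for i
    using that nonneg by (subst (asm) sum_nonneg_eq_0_iff) auto
  then have "u i = 0" if "i < n" for i
    using sqsum_eq_0[OF direct_sum_D[OF u that] that] that by simp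
  then show "u = 0" using u by (auto simp: direct_sum_def fun_eq_iff not_less[symmetric])
qed

section \<open>Finitely supported cochains are dense\<close>

definition truncate :: "'v set \<Rightarrow> ('v list \<Rightarrow> complex) \<Rightarrow> 'v list \<Rightarrow> complex" where
  "truncate W f xs = (if set xs \<subseteq> W then f xs else 0)"

lemma truncate_mem_cochains_c:
  assumes W: "finite W" and f: "alternating_cochain V m i f"
  shows "truncate W f \<in> cochains_c V m i"
proof -
  have "alternating_cochain V m i (truncate W f)"
    using f by (simp add: alternating_cochain_def truncate_def)
  moreover have "{xs. truncate W f xs \<noteq> 0} \<subseteq> {xs. set xs \<subseteq> W \<and> length xs = Suc i}"
    using f length_simplex by (auto simp: alternating_cochain_def truncate_def split: if_splits)
  ultimately show ?thesis
    using finite_subset[OF _ finite_lists_length_eq[OF W]] by (auto simp: cochains_c_def)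
qed

lemma cochains_c_subset_L2: "cochains_c V m i \<subseteq> L2 i"
proof
  fix f assume f: "f \<in> cochains_c V m i"
  then have "finite {xs. f xs \<noteq> 0}" by (simp add: cochains_c_def)
  then have "(\<lambda>xs. m i xs * (cmod (f xs))\<^sup>2) summable_on {xs. f xs \<noteq> 0} \<inter> S i"
    by (intro summable_on_finite) simp
  then have "(\<lambda>xs. m i xs * (cmod (f xs))\<^sup>2) summable_on S i"
    by (rule summable_on_cong_neutral[THEN iffD1, rotated -1]) auto
  then show "f \<in> L2 i" using f by (simp add: cochains_c_def cochains_l2_def)
qed

text \<open>A finite set of simplices has finitely many vertices, hence lies inside some \<open>U k\<close>. So
  the simplices inside \<open>U k\<close> eventually contain every finite set of simplices, and the
  discarded part is the tail of a convergent sum.\<close>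

lemma sqsum_truncate_tendsto:
  assumes U: "incseq U" "(\<Union>k. U k) = V" "\<And>k. finite (U k)" and f: "f \<in> L2 i"
  shows "(\<lambda>k. sqsum i (truncate (U k) f - f)) \<longlonglongrightarrow> 0"
proof -
  let ?h = "\<lambda>xs. m i xs * (cmod (f xs))\<^sup>2"
  define G where "G k = {xs \<in> S i. set xs \<subseteq> U k}" for k
  have fin: "finite (G k)" for k
    by (rule finite_subset[OF _ finite_lists_length_eq[OF U(3)[of k], of "Suc i"]])
      (auto simp: G_def length_simplex)
  have "filterlim G (finite_subsets_at_top (S i)) sequentially"
    unfolding filterlim_finite_subsets_at_top
  proof (intro allI impI)
    fix X assume X: "finite X \<and> X \<subseteq> S i"
    then have "finite (\<Union>(set ` X))" "\<Union>(set ` X) \<subseteq> (\<Union>k. U k)"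
      unfolding U(2) by (auto simp: mem_simplices_iff subset_iff)
    moreover have "U k \<subseteq> U l \<or> U l \<subseteq> U k" for k l
      using incseqD[OF U(1)] linear[of k l] by blast
    then have "subset.chain UNIV (range U)" by (auto simp: subset_chain_def)
    ultimately obtain k0 where "\<Union>(set ` X) \<subseteq> U k0"
      using finite_subset_Union_chain[of "\<Union>(set ` X)" "range U" UNIV] by blast
    then have "X \<subseteq> G k" if "k0 \<le> k" for k
      using X incseqD[OF U(1) that] by (auto simp: G_def)
    then show "\<forall>\<^sub>F k in sequentially. finite (G k) \<and> X \<subseteq> G k \<and> G k \<subseteq> S i"
      using fin by (intro eventually_sequentiallyI[of k0]) (auto simp: G_def)
  qed
  then have lim: "(\<lambda>k. sum ?h (G k)) \<longlonglongrightarrow> sqsum i f"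
    using L2_has_sum[OF f] unfolding has_sum_def by (rule filterlim_compose[rotated])
  have "sqsum i (truncate (U k) f - f) = sqsum i f - sum ?h (G k)" for k
  proof -
    have "((\<lambda>xs. if xs \<in> G k then ?h xs else 0) has_sum sum ?h (G k)) (S i)"
      by (rule has_sum_cong_neutral[THEN iffD1, rotated -1, OF has_sum_finite[OF fin[of k]]])
        (auto simp: G_def)
    then have "((\<lambda>xs. ?h xs + - 1 * (if xs \<in> G k then ?h xs else 0)) has_sum
        sqsum i f + - 1 * sum ?h (G k)) (S i)"
      by (intro has_sum_add has_sum_cmult_right L2_has_sum[OF f])
    also have "?this \<longleftrightarrow> ((\<lambda>xs. m i xs * (cmod ((truncate (U k) f - f) xs))\<^sup>2) has_sum
        sqsum i f + - 1 * sum ?h (G k)) (S i)"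
      by (intro has_sum_cong) (auto simp: G_def truncate_def)
    finally show ?thesis unfolding sqsum_def by (simp add: infsumI)
  qed
  then show ?thesis using tendsto_diff[OF tendsto_const lim, of "sqsum i f"] by simp
qed

lemma dense_cochains_c:
  assumes U: "incseq U" "(\<Union>k. U k) = V" "\<And>k. finite (U k)"
  shows "dense_in H ip (direct_sum n (cochains_c V m))"
  unfolding dense_in_def
proof (intro conjI ballI)
  show sub: "direct_sum n (cochains_c V m) \<subseteq> H"
    using cochains_c_subset_L2 by (auto simp: direct_sum_def)
  fix F assume F: "F \<in> H"
  define s where "s k i = truncate (U k) (F i)" for k i
  have s: "s k \<in> direct_sum n (cochains_c V m)" for k
    using F truncate_mem_cochains_c[OF U(3)]
    by (auto simp: direct_sum_def s_def L2_alternating truncate_def)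
  have mem: "s k - F \<in> H" for k
    using inner_product_carrier.diff_mem[OF inner_product_carrier_H _ F] s sub by blast
  have "(\<lambda>k. sqrt (\<Sum>i<n. sqsum i (truncate (U k) (F i) - F i) / fact (i + 1)))
      \<longlonglongrightarrow> sqrt (\<Sum>i<n. 0 / fact (i + 1))"
    using U F
    by (intro tendsto_real_sqrt tendsto_sum tendsto_divide tendsto_const sqsum_truncate_tendsto)
      (auto simp: direct_sum_D)
  then have "hlim ip s F"
    by (simp add: hlim_def hnorm_def Re_ip_self[OF mem] s_def)
  then show "\<exists>s. (\<forall>k. s k \<in> direct_sum n (cochains_c V m)) \<and> hlim ip s F"
    using s by blast
qed

end

section \<open>The Gauss--Bonnet operator is symmetric and bounded\<close>

context bounded_degree_complex
begin

text \<open>Up to its sign, \<open>\<Phi>\<close> is the summand of \<open>\<langle>d f, g\<rangle>\<close> that deletes the last vertex. Moving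
  entry \<open>j\<close> to the end turns the \<open>j\<close>-th summand into \<open>(-1)\<^sup>i\<^sup>+\<^sup>1 \<Phi>\<close>, whatever \<open>j\<close> is, so that
  \<open>i + 2\<close> equal sums arise. They account for the quotient of the normalising factorials
  \<open>(i + 2)!\<close> and \<open>(i + 1)!\<close>, and summing \<open>\<Phi>\<close> over the last vertex first gives \<open>\<delta> g\<close>.\<close>

lemma coboundary_codiff_adjoint:
  assumes f: "f \<in> L2 i" and g: "g \<in> L2 (Suc i)" and i: "Suc i < n"
  shows "ip_at (Suc i) (coboundary V m i f) g = ip_at i f (codiff V m (Suc i) g)"
proof -
  let ?c = "move_to_end (Suc i)"
  define \<Phi> where "\<Phi> zs = complex_of_real (m (Suc i) zs) * cnj (f (butlast zs)) * g zs" for zs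
  let ?e = "(- 1) ^ Suc i :: complex"
  have \<Phi>: "\<Phi> summable_on S (Suc i)"
  proof -
    obtain t where "((\<lambda>zs. m (Suc i) zs * (cmod (f (butlast zs)))\<^sup>2) has_sum t) (S (Suc i))"
      using has_sum_extension[OF i _ L2_has_sum[OF f]] by auto
    then show ?thesis
      unfolding \<Phi>_def using g
      by (intro weighted_product_summable[OF i])
        (auto simp: cochains_l2_def intro: has_sum_imp_summable)
  qed
  have "((\<lambda>xs. ?e * \<Phi> (permute_list (?c j) xs)) has_sum ?e * infsum \<Phi> (S (Suc i))) (S (Suc i))"
    if j: "j \<le> Suc i" for j
    using has_sum_cmult_right[OF has_sum_infsum[OF \<Phi>], of ?e]
      has_sum_reindex_bij_betw[OF bij_betw_permute_list[OF move_to_end_permutes[OF j]],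
        of "\<lambda>xs. ?e * \<Phi> xs"] by simp
  then have sum: "((\<lambda>xs. \<Sum>j\<le>Suc i. ?e * \<Phi> (permute_list (?c j) xs)) has_sum
      (\<Sum>j\<le>Suc i. ?e * infsum \<Phi> (S (Suc i)))) (S (Suc i))"
    by (intro has_sum_finite_sum) auto
  have eq: "complex_of_real (m (Suc i) xs) * cnj (coboundary V m i f xs) * g xs =
      (\<Sum>j\<le>Suc i. ?e * \<Phi> (permute_list (?c j) xs))" if xs: "xs \<in> S (Suc i)" for xs
  proof -
    have "complex_of_real (m (Suc i) xs) * ((- 1) ^ j * cnj (f (butlast (permute_list (?c j) xs)))) * g xs =
        ?e * \<Phi> (permute_list (?c j) xs)" if j: "j \<le> Suc i" for j
    proof -
      have p: "?c j permutes {..<Suc (Suc i)}" using move_to_end_permutes[OF j] .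
      have "g (permute_list (?c j) xs) = (- 1) ^ (Suc i - j) * g xs"
        using L2_alternating[OF g] xs p length_simplex[OF xs] sign_move_to_end[OF j]
        unfolding alternating_cochain_def by simp
      moreover have "(- 1) ^ j = ?e * (- 1) ^ (Suc i - j)"
        using j by (simp only: flip: power_add) (auto simp: minus_one_power_iff)
      ultimately show ?thesis
        unfolding \<Phi>_def weight_permute[OF i xs p] by (simp only: mult_ac)
    qed
    then show ?thesis
      unfolding coboundary_eq[OF xs] by (simp add: sum_distrib_left sum_distrib_right del: sum.atMost_Suc)
  qed
  have "(\<Sum>\<^sub>\<infinity>xs\<in>S (Suc i). complex_of_real (m (Suc i) xs) * cnj (coboundary V m i f xs) * g xs) =
      (of_nat i + 2) * (?e * infsum \<Phi> (S (Suc i)))"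
    using infsumI[OF sum] eq by (simp add: add_ac cong: infsum_cong del: sum.atMost_Suc power_Suc)
  moreover have "?e * infsum \<Phi> (S (Suc i)) =
      (\<Sum>\<^sub>\<infinity>xs\<in>S i. complex_of_real (m i xs) * cnj (f xs) * codiff V m (Suc i) g xs)"
  proof -
    have "?e * (\<Sum>y\<in>N xs. \<Phi> (xs @ [y])) =
        complex_of_real (m i xs) * cnj (f xs) * codiff V m (Suc i) g xs" if xs: "xs \<in> S i" for xs
    proof -
      have "(\<Sum>y\<in>N xs. \<Phi> (xs @ [y])) =
          cnj (f xs) * (\<Sum>y\<in>N xs. of_real (m (Suc i) (xs @ [y])) * g (xs @ [y]))"
        by (simp add: \<Phi>_def sum_distrib_left mult_ac)
      then show ?thesis using weight_pos[of i xs] i xs by (simp add: codiff_def)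
    qed
    then show ?thesis
      using infsum_cmult_right[OF summable_on_snoc(1)[OF \<Phi>], of ?e] summable_on_snoc(2)[OF \<Phi>]
      by (simp cong: infsum_cong)
  qed
  moreover have "fact (Suc i + 1) = (of_nat i + 2) * (fact (i + 1) :: complex)"
    by (simp add: algebra_simps)
  moreover have "(of_nat i + 2 :: complex) \<noteq> 0"
    using of_nat_eq_0_iff[of "i + 2", where 'a = complex] by (simp add: add.commute del: of_nat_eq_0_iff)
  ultimately show ?thesis by (simp only: inner_l2_def) (simp add: divide_simps)
qed

abbreviation "D \<equiv> gauss_bonnet V m n"

lemma n_Suc: obtains k where "n = Suc k"
  using n_ge_2 by (cases n) auto

lemma gauss_bonnet_mem:
  assumes F: "F \<in> H"
  shows "D F \<in> H"
  unfolding direct_sum_def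
proof (intro CollectI conjI allI impI)
  fix i assume i: "i < n"
  have "(if 1 \<le> i \<and> i < n then coboundary V m (i - 1) (F (i - 1)) else 0) \<in> L2 i"
    using coboundary_bounded(1)[of "F (i - 1)" "i - 1"] direct_sum_D[OF F, of "i - 1"] i L2_zero
    by auto
  moreover have "(if i + 1 < n then codiff V m (i + 1) (F (i + 1)) else 0) \<in> L2 i"
    using codiff_bounded(1)[of "F (i + 1)" i] direct_sum_D[OF F, of "i + 1"] L2_zero by auto
  ultimately show "D F i \<in> L2 i" unfolding gauss_bonnet_def using L2_add(1) i by blast
qed (simp add: gauss_bonnet_def)

lemma coboundary_diff: "coboundary V m i (f - g) = coboundary V m i f - coboundary V m i g"
  by (simp add: fun_eq_iff coboundary_def sum_subtractf right_diff_distrib del: sum.atMost_Suc)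

lemma codiff_diff: "codiff V m i (f - g) = codiff V m i f - codiff V m i g"
  by (simp add: fun_eq_iff codiff_def sum_subtractf right_diff_distrib)

lemma gauss_bonnet_diff: "D (F - G) = D F - D G"
  by (rule ext) (simp add: gauss_bonnet_def coboundary_diff codiff_diff)

text \<open>Indexed by the lower of the two levels involved, the \<open>d\<close>-terms of one argument line up
  with the \<open>\<delta>\<close>-terms of the other.\<close>

lemma ip_gauss_bonnet:
  assumes F: "F \<in> H" and G: "G \<in> H"
  shows "ip F (D G) =
    (\<Sum>i<n - 1. ip_at (Suc i) (F (Suc i)) (coboundary V m i (G i))) +
    (\<Sum>i<n - 1. ip_at i (F i) (codiff V m (Suc i) (G (Suc i))))"
proof -
  obtain k where n: "n = Suc k" by (rule n_Suc)
  let ?d = "\<lambda>i. if 1 \<le> i \<and> i < n then coboundary V m (i - 1) (G (i - 1)) else 0"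
  let ?\<delta> = "\<lambda>i. if i + 1 < n then codiff V m (i + 1) (G (i + 1)) else 0"
  have zero: "ip_at i f 0 = 0" for i f by (simp add: inner_l2_def)
  have "ip_at i (F i) (D G i) = ip_at i (F i) (?d i) + ip_at i (F i) (?\<delta> i)" if i: "i < n" for i
    unfolding gauss_bonnet_def
  proof (rule ip_at_add_right[OF direct_sum_D[OF F i] _ _ i])
    show "?d i \<in> L2 i"
      using coboundary_bounded(1)[of "G (i - 1)" "i - 1"] direct_sum_D[OF G, of "i - 1"] i L2_zero
      by auto
    show "?\<delta> i \<in> L2 i"
      using codiff_bounded(1)[of "G (i + 1)" i] direct_sum_D[OF G, of "i + 1"] L2_zero by auto
  qed
  then have "ip F (D G) = (\<Sum>i<n. ip_at i (F i) (?d i)) + (\<Sum>i<n. ip_at i (F i) (?\<delta> i))"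
    by (simp add: inner_sum_def sum.distrib)
  also have "(\<Sum>i<n. ip_at i (F i) (?d i)) =
      (\<Sum>i<n - 1. ip_at (Suc i) (F (Suc i)) (coboundary V m i (G i)))"
    unfolding n sum.lessThan_Suc_shift by (simp add: zero)
  also have "(\<Sum>i<n. ip_at i (F i) (?\<delta> i)) =
      (\<Sum>i<n - 1. ip_at i (F i) (codiff V m (Suc i) (G (Suc i))))"
    unfolding n by (simp add: zero)
  finally show ?thesis .
qed

lemma gauss_bonnet_symmetric:
  assumes F: "F \<in> H" and G: "G \<in> H"
  shows "ip (D F) G = ip F (D G)"
proof -
  have adj: "ip_at (Suc i) (coboundary V m i (f i)) (g (Suc i)) =
      ip_at i (f i) (codiff V m (Suc i) (g (Suc i)))"
    if "i < n - 1" "f \<in> H" "g \<in> H" for i f g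
    using that by (intro coboundary_codiff_adjoint direct_sum_D) auto
  have "ip (D F) G = cnj (ip G (D F))"
    using inner_product_carrier.ip_commute[OF inner_product_carrier_H G gauss_bonnet_mem[OF F]] .
  also have "\<dots> = (\<Sum>i<n - 1. ip_at (Suc i) (coboundary V m i (F i)) (G (Suc i))) +
      (\<Sum>i<n - 1. ip_at i (codiff V m (Suc i) (F (Suc i))) (G i))"
    unfolding ip_gauss_bonnet[OF G F] by (simp flip: inner_commute)
  also have "(\<Sum>i<n - 1. ip_at (Suc i) (coboundary V m i (F i)) (G (Suc i))) =
      (\<Sum>i<n - 1. ip_at i (F i) (codiff V m (Suc i) (G (Suc i))))"
    using adj F G by (intro sum.cong) auto
  also have "(\<Sum>i<n - 1. ip_at i (codiff V m (Suc i) (F (Suc i))) (G i)) =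
      (\<Sum>i<n - 1. ip_at (Suc i) (F (Suc i)) (coboundary V m i (G i)))"
    using adj[OF _ G F] inner_commute by (intro sum.cong) (metis lessThan_iff)+
  finally show ?thesis unfolding ip_gauss_bonnet[OF F G] by simp
qed

text \<open>A crude bound is enough: every level of \<open>D F\<close> is compared with the sum \<open>Q\<close> over all levels
  of \<open>F\<close>, and \<open>n!\<close> compensates for the normalising factorials.\<close>

lemma gauss_bonnet_bounded:
  obtains B where "\<And>F. F \<in> H \<Longrightarrow> hnorm ip (D F) \<le> B * hnorm ip F"
proof -
  define C where "C = 2 * ((real n + 2)\<^sup>2 * K) + 2 * K"
  have bound: "(hnorm ip (D F))\<^sup>2 \<le> (real n * C * fact n) * (hnorm ip F)\<^sup>2" if F: "F \<in> H" for F
  proof -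
    define Q where "Q = (\<Sum>j<n. sqsum j (F j))"
    have Q: "sqsum j (F j) \<le> Q" if "j < n" for j
      unfolding Q_def using that sqsum_nonneg by (intro member_le_sum) auto
    have Q0: "0 \<le> Q" unfolding Q_def by (intro sum_nonneg sqsum_nonneg) simp
    have step: "sqsum i (D F i) \<le> C * Q" if i: "i < n" for i
    proof -
      let ?d = "if 1 \<le> i \<and> i < n then coboundary V m (i - 1) (F (i - 1)) else 0"
      let ?\<delta> = "if i + 1 < n then codiff V m (i + 1) (F (i + 1)) else 0"
      have zero: "sqsum i 0 = 0" by (simp add: sqsum_def)
      have d: "?d \<in> L2 i \<and> sqsum i ?d \<le> (real n + 2)\<^sup>2 * K * Q"
      proof (cases "1 \<le> i")
        case True
        then obtain j where j: "i = Suc j" by (cases i) auto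
        have "sqsum i ?d \<le> (real j + 2)\<^sup>2 * K * sqsum j (F j)"
          using coboundary_bounded(2)[OF direct_sum_D[OF F]] i j by simp
        also have "\<dots> \<le> (real n + 2)\<^sup>2 * K * Q"
          using i j Q[of j] Q0 K_nonneg sqsum_nonneg[of j]
          by (intro mult_mono power_mono mult_nonneg_nonneg) auto
        finally show ?thesis
          using coboundary_bounded(1)[OF direct_sum_D[OF F], of j] i j by simp
      next
        case False
        then show ?thesis using L2_zero zero K_nonneg Q0 by simp
      qed
      have \<delta>: "?\<delta> \<in> L2 i \<and> sqsum i ?\<delta> \<le> K * Q"
      proof (cases "i + 1 < n")
        case True
        have "sqsum i ?\<delta> \<le> K * sqsum (Suc i) (F (Suc i))"
          using codiff_bounded(2)[OF direct_sum_D[OF F]] True by simp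
        also have "\<dots> \<le> K * Q" using Q[of "Suc i"] True K_nonneg by (intro mult_left_mono) auto
        finally show ?thesis using codiff_bounded(1)[OF direct_sum_D[OF F]] True by simp
      next
        case False
        then show ?thesis using L2_zero zero K_nonneg Q0 by simp
      qed
      have "sqsum i (?d + ?\<delta>) \<le> 2 * sqsum i ?d + 2 * sqsum i ?\<delta>"
        using L2_add(2) d \<delta> i by blast
      also have "\<dots> \<le> C * Q" using d \<delta> unfolding C_def distrib_right by linarith
      finally show ?thesis unfolding gauss_bonnet_def .
    qed
    have "(hnorm ip (D F))\<^sup>2 = (\<Sum>i<n. sqsum i (D F i) / fact (i + 1))"
      using inner_product_carrier.hnorm_sq[OF inner_product_carrier_H gauss_bonnet_mem[OF F]]
        Re_ip_self[OF gauss_bonnet_mem[OF F]] by simp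
    also have "\<dots> \<le> (\<Sum>i<n. C * Q)"
    proof (rule sum_mono)
      fix i assume "i \<in> {..<n}"
      then have i: "i < n" by simp
      have "sqsum i (D F i) / fact (i + 1) \<le> sqsum i (D F i) / 1"
        using sqsum_nonneg[OF i] fact_ge_1[of "i + 1", where 'a = real]
        by (intro divide_left_mono) auto
      then show "sqsum i (D F i) / fact (i + 1) \<le> C * Q" using step[OF i] by simp
    qed
    also have "\<dots> = real n * C * Q" by simp
    also have "\<dots> \<le> real n * C * (fact n * (hnorm ip F)\<^sup>2)"
    proof (rule mult_left_mono)
      have "Q \<le> (\<Sum>j<n. fact n * (sqsum j (F j) / fact (j + 1)))"
        unfolding Q_def
      proof (rule sum_mono)
        fix j assume "j \<in> {..<n}"
        then have j: "j < n" by simp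
        have "fact (j + 1) \<le> (fact n :: real)" using j by (intro fact_mono) simp
        then have "fact (j + 1) * sqsum j (F j) \<le> fact n * sqsum j (F j)"
          using sqsum_nonneg[OF j] by (rule mult_right_mono)
        moreover have "0 < (fact (j + 1) :: real)" by (rule fact_gt_zero)
        ultimately show "sqsum j (F j) \<le> fact n * (sqsum j (F j) / fact (j + 1))"
          by (simp add: field_simps del: fact_Suc)
      qed
      then show "Q \<le> fact n * (hnorm ip F)\<^sup>2"
        using inner_product_carrier.hnorm_sq[OF inner_product_carrier_H F] Re_ip_self[OF F]
        by (simp add: sum_distrib_left)
      show "0 \<le> real n * C" using K_nonneg by (simp add: C_def)
    qed
    finally show ?thesis by (simp add: mult.assoc)
  qed
  have "hnorm ip (D F) \<le> sqrt (real n * C * fact n) * hnorm ip F" if F: "F \<in> H" for F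
  proof -
    have "0 \<le> hnorm ip F" "0 \<le> hnorm ip (D F)"
      using inner_product_carrier.ip_nonneg[OF inner_product_carrier_H] F gauss_bonnet_mem[OF F]
      by (simp_all add: hnorm_def)
    then show ?thesis using real_sqrt_le_mono[OF bound[OF F]] by (simp add: real_sqrt_mult)
  qed
  then show ?thesis using that by blast
qed

lemma gauss_bonnet_essentially_self_adjoint:
  assumes U: "incseq U" "(\<Union>k. U k) = V" "\<And>k. finite (U k)"
  shows "essentially_self_adjoint H ip (direct_sum n (cochains_c V m)) D"
proof -
  obtain B where "\<And>F. F \<in> H \<Longrightarrow> hnorm ip (D F) \<le> B * hnorm ip F"
    using gauss_bonnet_bounded by blast
  then show ?thesis
    using inner_product_carrier.essentially_self_adjoint_bounded_symmetric[OF
        inner_product_carrier_H dense_cochains_c[OF U] gauss_bonnet_mem gauss_bonnet_diff]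
      gauss_bonnet_symmetric by blast
qed

end

section \<open>Essential self-adjointness\<close>

theorem theorem4p10:
  fixes V :: "'v set" and m :: "nat \<Rightarrow> 'v list \<Rightarrow> real" and n :: nat
  assumes "weighted_complex V m n"
    and "locally_finite V m"
  shows "((\<exists>U chi. cutoff_sequence V U chi) \<and>
          (\<forall>i\<in>{0..n - 2}. bdd_above (weighted_degree V m i ` simplices V m i)) \<longrightarrow>
            essentially_self_adjoint
              (direct_sum n (cochains_l2 V m)) (inner_sum V m n)
              (direct_sum n (cochains_c V m)) (gauss_bonnet V m n)) \<and>
         (globally_chi_complete V m n \<and>
          (\<forall>i\<in>{0..n - 2}. bdd_above (weighted_degree V m i ` simplices V m i)) \<longrightarrow>
            essentially_self_adjoint
              (direct_sum n (cochains_l2 V m)) (inner_sum V m n)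
              (direct_sum n (cochains_c V m)) (gauss_bonnet V m n))"
proof -
  have main: "essentially_self_adjoint
              (direct_sum n (cochains_l2 V m)) (inner_sum V m n)
              (direct_sum n (cochains_c V m)) (gauss_bonnet V m n)"
    if cutoff: "cutoff_sequence V U chi"
      and bdd: "\<forall>i\<in>{0..n - 2}. bdd_above (weighted_degree V m i ` simplices V m i)" for U chi
  proof -
    have "\<exists>b. \<forall>xs\<in>simplices V m i. weighted_degree V m i xs \<le> b" if "Suc i < n" for i
      using bdd that by (auto simp: bdd_above_def)
    then obtain b where b: "\<And>i xs. Suc i < n \<Longrightarrow> xs \<in> simplices V m i \<Longrightarrow> weighted_degree V m i xs \<le> b i"
      by metis
    \<comment> \<open>One constant for all levels: the sum of the absolute values dominates each bound.\<close>
    interpret bounded_degree_complex V m n "\<Sum>i<n. \<bar>b i\<bar>"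
    proof
      fix i xs assume i: "Suc i < n" and xs: "xs \<in> simplices V m i"
      have "\<bar>b i\<bar> \<le> (\<Sum>i<n. \<bar>b i\<bar>)" using i by (intro member_le_sum) auto
      then show "weighted_degree V m i xs \<le> (\<Sum>i<n. \<bar>b i\<bar>)" using b[OF i xs] by linarith
    qed (use assms in \<open>auto intro: sum_nonneg\<close>)
    show ?thesis
      using cutoff by (intro gauss_bonnet_essentially_self_adjoint[of U]) (auto simp: cutoff_sequence_def)
  qed
  then show ?thesis by (auto simp: globally_chi_complete_def)
qed

end
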